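(* Let $N\ge1$ be an integer. (i) If $1\le m\le N$ is an integer, then \[ \int_0^\infty \left\{ \binom{2N-m}{N-m}\operatorname{sech} x - \sum_{j=m}^{N}\binom{2N-j-1}{N-j}\operatorname{sech}^j x \right\}\frac{dx}{x^2} = \sum_{j=m}^{N}\binom{2N-j-1}{N-j}\mathcal F_j . \] (ii) With $C_N=\frac{1}{N+1}\binom{2N}{N}$ the $N$th Catalan number, \[ \int_0^\infty \left\{ C_N\operatorname{sech} x - \sum_{j=1}^{N} \frac{j}{N} \binom{2N-j-1}{N-1}\operatorname{sech}^j x \right\}\frac{dx}{x^2} = \sum_{j=1}^{N} \frac{j}{N} \binom{2N-j-1}{N-1}\mathcal F_j . \]
   Context: The signed generalized Stirling polynomials $P_k(m,x)$, $0\le k\le m$, are defined by the polynomial identity in an indeterminate $y$: $\prod_{i=1}^{m}(y+i-x)=\sum_{k=0}^{m}(-1)^kP_k(m,x)\,y^{m-k}$. Let $\zeta(s,a)$ be the Hurwitz zeta function (meromorphically continued in $s$), $\zeta'(s,a)=\partial_s\zeta(s,a)$, and $G=\sum_{k\ge0}(-1)^k/(2k+1)^2$ Catalan's constant. Define $\mathcal F_1=0$ and, for integers $j\ge2$, \[ \begin{aligned} \mathcal F_j={}&-\frac{4G}{\pi} +\frac{2^{2j-3}j^2}{(j-1)!} \sum_{m=0}^{j-1}\left(-\tfrac12\right)^m P_m\!\left(j-1,\tfrac{j}{2}\right) \left[\zeta'\!\left(m-j+2,\tfrac{j}{4}\right)-\zeta'\!\left(m-j+2,\tfrac{j+2}{4}\right)\right]\\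 &-\frac{2^{2j+1}}{(j-1)!} \sum_{m=0}^{j+1}\left(-\tfrac12\right)^m P_m\!\left(j+1,\tfrac{j+2}{2}\right) \left[\zeta'\!\left(m-j,\tfrac{j+2}{4}\right)-\zeta'\!\left(m-j,\tfrac{j+4}{4}\right)\right], \end{aligned} \] where any bracket whose first argument equals $1$ is interpreted as the finite limit $\lim_{s\to1}[\zeta'(s,a)-\zeta'(s,b)]$ (equal to $-\gamma_1(a)+\gamma_1(b)$ in terms of generalized Stieltjes constants). *)

theory Defs
  imports
    "HOL-Complex_Analysis.Complex_Analysis"
    "HOL-Computational_Algebra.Polynomial"
begin

definition sech :: "real \<Rightarrow> real" where
  "sech x = 1 / cosh x"

definition catalan_const :: real where
  "catalan_const = (\<Sum>k. (-1) ^ k / (2 * real k + 1)\<^sup>2)"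

text \<open>
  \<open>gen_stirling k m x\<close> is \<open>P\<^sub>k(m,x)\<close>, obtained by reading off the coefficient of \<open>y\<^bsup>m-k\<^esup>\<close>;
  the polynomial variable plays the role of the indeterminate \<open>y\<close>.
\<close>

definition gen_stirling :: "nat \<Rightarrow> nat \<Rightarrow> 'a \<Rightarrow> 'a :: comm_ring_1" where
  "gen_stirling k m x = (-1) ^ k * coeff (\<Prod>i=1..m. [:of_nat i - x, 1:]) (m - k)"

lemma gen_stirling_identity:
  fixes x :: "'a :: comm_ring_1"
  shows "(\<Prod>i=1..m. [:of_nat i - x, 1:]) = (\<Sum>k\<le>m. monom ((-1) ^ k * gen_stirling k m x) (m - k))"
proof -
  let ?p = "\<Prod>i=1..m. [:of_nat i - x, 1:]"
  have "degree ?p \<le> (\<Sum>i=1..m. degree [:of_nat i - x, 1:])"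
    using degree_prod_sum_le[of "{1..m}" "\<lambda>i. [:of_nat i - x, 1:]"] by (simp add: o_def)
  also have "\<dots> = m" by simp
  finally have "degree ?p \<le> m" .
  then have "?p = (\<Sum>k\<le>m. monom (coeff ?p k) k)"
    by (rule poly_as_sum_of_monoms'[symmetric])
  also have "\<dots> = (\<Sum>k\<le>m. monom (coeff ?p (m - k)) (m - k))"
    by (rule sum.reindex_bij_witness[of _ "\<lambda>k. m - k" "\<lambda>k. m - k"]) auto
  also have "\<dots> = (\<Sum>k\<le>m. monom ((-1) ^ k * gen_stirling k m x) (m - k))"
  proof (intro sum.cong refl)
    fix k
    have "(-1) ^ k * ((-1) ^ k * c) = c" for c :: 'a
      by (induction k) auto
    then show "monom (coeff ?p (m - k)) (m - k) = monom ((-1) ^ k * gen_stirling k m x) (m - k)"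
      unfolding gen_stirling_def by presburger
  qed
  finally show ?thesis .
qed

text \<open>
  For \<open>a > 0\<close>, the meromorphic function on the whole plane that agrees with the Hurwitz series on
  \<open>Re s > 1\<close>. Since \<open>nicely_meromorphic_on\<close> forces removable singularities to be removed and the
  value at a pole to be \<open>0\<close>, this determines the function everywhere, with junk value \<open>0\<close> at its
  only pole \<open>s = 1\<close>.
\<close>

definition hurwitz_zeta :: "complex \<Rightarrow> real \<Rightarrow> complex" where
  "hurwitz_zeta s a =
     (THE f. f nicely_meromorphic_on UNIV \<and>
             (\<forall>z. Re z > 1 \<longrightarrow> f z = (\<Sum>n. of_real (real n + a) powr (-z)))) s"

definition hurwitz_zeta_deriv :: "complex \<Rightarrow> real \<Rightarrow> complex" where
  "hurwitz_zeta_deriv s a = deriv (\<lambda>z. hurwitz_zeta z a) s"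

definition zeta_bracket :: "complex \<Rightarrow> real \<Rightarrow> real \<Rightarrow> complex" where
  "zeta_bracket s a b =
     (if s = 1 then Lim (at 1) (\<lambda>z. hurwitz_zeta_deriv z a - hurwitz_zeta_deriv z b)
      else hurwitz_zeta_deriv s a - hurwitz_zeta_deriv s b)"

text \<open>
  The definition is meant for \<open>j \<ge> 1\<close>. The values are real, but they are kept in \<^typ>\<open>complex\<close>
  because the zeta function is.
\<close>

definition sech_F :: "nat \<Rightarrow> complex" where
  "sech_F j =
     (if j \<le> 1 then 0 else
        - of_real (4 * catalan_const / pi)
        + 2 ^ (2 * j - 3) * of_nat j ^ 2 / fact (j - 1) *
          (\<Sum>m=0..j-1. (-1/2) ^ m * gen_stirling m (j - 1) (of_nat j / 2) *
             zeta_bracket (of_nat m - of_nat j + 2) (real j / 4) ((real j + 2) / 4))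
        - 2 ^ (2 * j + 1) / fact (j - 1) *
          (\<Sum>m=0..j+1. (-1/2) ^ m * gen_stirling m (j + 1) ((of_nat j + 2) / 2) *
             zeta_bracket (of_nat m - of_nat j) ((real j + 2) / 4) ((real j + 4) / 4)))"

end

theory Submission
  imports Defs "HOL-Real_Asymp.Real_Asymp"
begin

text \<open>
  By linearity and two binomial identities it suffices that \<open>\<F>\<^sub>j\<close> is the integral of
  \<open>(sech x - sech\<^sup>j x) / x\<^sup>2\<close>. Put \<open>f = sech\<^sup>j\<close>. Integrating by parts twice,
  \<open>\<integral>(1 - f x) / x\<^sup>2 dx = \<integral>ln x f'' x dx\<close>, which is the derivative at \<open>s = 1\<close> of the Mellin transform of
  \<open>f'' = j\<^sup>2 sech\<^sup>j - j (j + 1) sech\<^bsup>j+2\<^esup>\<close>. Expanding \<open>sech\<^sup>j\<close> in powers of \<open>e\<^bsup>-2x\<^esup>\<close> expresses its Mellin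
  transform, divided by \<open>\<Gamma>(s)\<close>, through alternating Hurwitz series; both sides are entire in \<open>s\<close>, so the
  identity persists at \<open>s = 1\<close>. As the transform of \<open>f''\<close> vanishes there (\<open>\<integral>f'' = 0\<close>), the derivatives of
  \<open>\<Gamma>(s)\<close> and \<open>4\<^bsup>-s\<^esup>\<close> drop out and only the zeta brackets remain. Finally
  \<open>\<integral>(1 - sech x) / x\<^sup>2 dx = 4G / \<pi>\<close> by integrating the partial fraction expansion of \<open>sech\<close> termwise.
\<close>

subsection \<open>Mellin transforms\<close>

text \<open>The expansion of \<open>sech x ^ j\<close> yields a Dirichlet series with coefficients
  of order n^(j-1), absolutely convergent only for Re s > j. The derivative is wanted at s = 1, and
  the brackets sit at the integers from -j to 1, where Mellin integrals diverge or a single zeta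
  function has its pole. Dividing by Gamma(s) cancels the poles of a Mellin transform at 0, -1, ...,
  and pairing zeta(s,a) with zeta(s,a+1/2) cancels the pole at 1, so all functions compared are
  entire. Continuing a Mellin transform takes arbitrarily many integrations by parts, hence decay of
  all derivatives; decay on a complex half-strip gives it through Cauchy's estimate. The constants
  come from the exponents 2n + j = 4 (n/2 + j/4): the 4 produces 4^(-s), the step 1/2 the pairs a, a
  + 1/2, and the Stirling polynomials rewrite the binomial coefficient of the series as a polynomial
  in n + j/2, each power of which shifts s by an integer. The term -4G/pi is there because sech^j is
  compared with sech instead of 1.\<close>

abbreviation (input) halfline :: "real measure" where
  "halfline \<equiv> restrict_space lborel {0<..}"

lemma borel_measurable_halfline:
  fixes f :: "real \<Rightarrow> 'a :: topological_space"
  assumes "continuous_on {0<..} f"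
  shows "f \<in> borel_measurable halfline"
  using borel_measurable_continuous_on_restrict[OF assms]
  by (simp cong: measurable_cong_sets sets_restrict_space_cong)

lemma has_bochner_integral_halfline_iff:
  fixes f :: "real \<Rightarrow> 'a :: {banach, second_countable_topology}"
  shows "has_bochner_integral halfline f I \<longleftrightarrow>
         has_bochner_integral lborel (\<lambda>x. indicator {0<..} x *\<^sub>R f x) I"
  by (simp add: has_bochner_integral_iff integrable_restrict_space integral_restrict_space)

text \<open>The substitution x -> c x in Euler's integral gives Gamma(s)/c; the factor c^(1-s) then
  restores x^(s-1) and leaves c^(-s).\<close>

lemma has_bochner_integral_Gamma:
  assumes "Re s > 0" "c > 0"
  shows "has_bochner_integral halfline
           (\<lambda>x. of_real x powr (s - 1) * of_real (exp (- (c * x)))) (Gamma s / of_real c powr s)"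
proof -
  let ?f = "\<lambda>t. complex_of_real t powr (s - 1) / of_real (exp t)"
  let ?g = "\<lambda>t. indicator {0<..} t *\<^sub>R ?f t"
  have cont: "continuous_on {0<..} ?f"
    by (intro continuous_intros) auto
  have meas: "?f \<in> borel_measurable halfline"
    by (rule borel_measurable_halfline[OF cont])
  then have [measurable]: "?g \<in> borel_measurable lborel"
    by (subst (asm) borel_measurable_restrict_space_iff) auto
  have "integrable lebesgue ?g"
    using absolutely_integrable_Gamma_integral'[OF assms(1)] by (simp add: set_integrable_def)
  moreover have "(?f has_integral integral\<^sup>L lebesgue ?g) {0<..}"
    using has_integral_set_lebesgue[OF absolutely_integrable_Gamma_integral'[OF assms(1)]]
    by (simp add: set_lebesgue_integral_def)
  then have "integral\<^sup>L lebesgue ?g = Gamma s"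
    using Gamma_integral_complex'[OF assms(1)] has_integral_unique by blast
  ultimately have "has_bochner_integral lborel ?g (Gamma s)"
    by (auto simp: has_bochner_integral_iff integrable_completion integral_completion)
  then have "has_bochner_integral lborel (\<lambda>x. ?g (0 + c * x)) (Gamma s /\<^sub>R \<bar>c\<bar>)"
    using assms(2) by (subst (asm) lborel_has_bochner_integral_real_affine_iff[of c _ _ 0]) auto
  then have "has_bochner_integral lborel (\<lambda>x. of_real c powr (1 - s) * ?g (0 + c * x))
               (of_real c powr (1 - s) * (Gamma s /\<^sub>R \<bar>c\<bar>))"
    by (rule has_bochner_integral_mult_right)
  also have "of_real c powr (1 - s) * (Gamma s /\<^sub>R \<bar>c\<bar>) = Gamma s / of_real c powr s"
    using assms(2) by (simp add: powr_diff scaleR_conv_of_real field_simps)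
  also have "(\<lambda>x. of_real c powr (1 - s) * ?g (0 + c * x)) =
             (\<lambda>x. indicator {0<..} x *\<^sub>R (of_real x powr (s - 1) * complex_of_real (exp (- (c * x)))))"
  proof
    fix x :: real
    have "complex_of_real c powr (1 - s) * (of_real (c * x) powr (s - 1) / of_real (exp (c * x))) =
           of_real x powr (s - 1) * of_real (exp (- (c * x)))" if "x > 0"
    proof -
      have "complex_of_real (c * x) powr (s - 1) = of_real c powr (s - 1) * of_real x powr (s - 1)"
        using that assms(2) by (simp add: powr_times_real)
      moreover have "complex_of_real c powr (1 - s) * of_real c powr (s - 1) = 1"
        using assms(2) by (simp flip: powr_add)
      ultimately show ?thesis
        by (simp add: exp_minus field_simps exp_of_real)
    qed
    then show "of_real c powr (1 - s) * ?g (0 + c * x) =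
        indicator {0<..} x *\<^sub>R (of_real x powr (s - 1) * complex_of_real (exp (- (c * x))))"
      using assms(2) by (auto simp: indicator_def zero_less_mult_iff)
  qed
  finally show ?thesis
    by (simp add: has_bochner_integral_halfline_iff)
qed

lemma has_bochner_integral_Gamma_real:
  assumes "s > 0" "c > 0"
  shows "has_bochner_integral halfline (\<lambda>x. x powr (s - 1) * exp (- (c * x))) (Gamma s / c powr s)"
proof -
  have "has_bochner_integral halfline
           (\<lambda>x. Re (of_real x powr (of_real s - 1) * of_real (exp (- (c * x)))))
           (Re (Gamma (of_real s) / of_real c powr of_real s))"
    using has_bochner_integral_Gamma[of "of_real s" c] assms
    by (intro has_bochner_integral_Re) auto
  also have "Re (Gamma (of_real s) / of_real c powr of_real s) = Gamma s / c powr s"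
    using assms by (simp add: powr_of_real Gamma_complex_of_real Re_divide_of_real)
  finally show ?thesis
    by (rule has_bochner_integral_cong[THEN iffD1, rotated 3])
       (auto simp: space_restrict_space powr_of_real powr_Reals_eq)
qed

text \<open>Boundary values enter as limits because the antiderivatives in use, containing x^s or ln
  x, need not be regular at 0.\<close>

lemma halfline_FTC:
  fixes f F :: "real \<Rightarrow> 'a :: euclidean_space"
  assumes F: "\<And>x. x > 0 \<Longrightarrow> (F has_vector_derivative f x) (at x)"
    and f: "continuous_on {0<..} f" and int: "integrable halfline f"
    and A: "(F \<longlongrightarrow> A) (at_right 0)" and B: "(F \<longlongrightarrow> B) at_top"
  shows "integral\<^sup>L halfline f = B - A"
proof -
  have ein: "einterval 0 \<infinity> = {0<..}"
    by (auto simp: einterval_def)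
  have "(LBINT x=0..\<infinity>. f x) = B - A"
  proof (rule interval_integral_FTC_integrable)
    show "set_integrable lborel (einterval 0 \<infinity>) f"
      using int by (simp add: ein set_integrable_def integrable_restrict_space)
    show "((F \<circ> real_of_ereal) \<longlongrightarrow> A) (at_right 0)" "((F \<circ> real_of_ereal) \<longlongrightarrow> B) (at_left \<infinity>)"
      using A B by (auto simp: ereal_tendsto_simps zero_ereal_def)
    show "isCont f x" if "0 < ereal x" "ereal x < \<infinity>" for x
      using f that by (auto simp: continuous_on_eq_continuous_at)
  qed (use F in auto)
  then show ?thesis
    by (simp add: interval_lebesgue_integral_def ein set_lebesgue_integral_def
        integral_restrict_space)
qed

section \<open>Mellin transforms of exponentially decaying functions\<close>

definition exp_decay :: "(real \<Rightarrow> complex) \<Rightarrow> bool" where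
  "exp_decay g \<longleftrightarrow> continuous_on {0<..} g \<and> (\<exists>C c. c > 0 \<and> (\<forall>x>0. norm (g x) \<le> C * exp (- (c * x))))"

definition mellin :: "(real \<Rightarrow> complex) \<Rightarrow> complex \<Rightarrow> complex" where
  "mellin g s = (\<integral>x. of_real x powr (s - 1) * g x \<partial>halfline)"

text \<open>The exponential bound covers all x > 0, so \<open>g\<close> is bounded near 0 and Re s >
  0 suffices there; a real Gamma integral dominates.\<close>

lemma mellin_integrable:
  assumes "exp_decay g" "Re s > 0"
  shows "integrable halfline (\<lambda>x. of_real x powr (s - 1) * g x)"
proof -
  obtain C c where c: "c > 0" and C: "\<And>x. x > 0 \<Longrightarrow> norm (g x) \<le> C * exp (- (c * x))"
    and g: "continuous_on {0<..} g"
    using assms(1) by (auto simp: exp_decay_def)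
  show ?thesis
  proof (rule Bochner_Integration.integrable_bound)
    show "integrable halfline (\<lambda>x. C * (x powr (Re s - 1) * exp (- (c * x))))"
      using has_bochner_integral_Gamma_real[OF assms(2) c]
      by (intro integrable_mult_right) (simp add: has_bochner_integral_iff)
    show "(\<lambda>x. of_real x powr (s - 1) * g x) \<in> borel_measurable halfline"
      by (intro borel_measurable_halfline continuous_intros g) auto
    show "AE x in halfline. norm (of_real x powr (s - 1) * g x)
            \<le> norm (C * (x powr (Re s - 1) * exp (- (c * x))))"
    proof (rule AE_I2)
      fix x assume "x \<in> space halfline"
      then have x: "x > 0" by (simp add: space_restrict_space)
      have "norm (of_real x powr (s - 1) * g x) = x powr (Re s - 1) * norm (g x)"
        using x by (simp add: norm_mult norm_powr_real_powr)
      also have "\<dots> \<le> x powr (Re s - 1) * (C * exp (- (c * x)))"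
        by (intro mult_left_mono C x) auto
      finally show "norm (of_real x powr (s - 1) * g x)
            \<le> norm (C * (x powr (Re s - 1) * exp (- (c * x))))"
        by (simp add: mult_ac abs_mult) (smt (verit) mult_nonneg_nonneg exp_ge_zero abs_ge_self mult_right_mono powr_ge_zero mult.assoc)
    qed
  qed
qed

lemma norm_exp_minus_one_le:
  fixes z :: complex
  shows "norm (exp z - 1) \<le> norm z * exp (norm z)"
proof -
  have "norm (exp z - exp 0) \<le> exp (norm z) * norm (z - 0)"
  proof (rule field_differentiable_bound[of "cball 0 (norm z)"])
    show "norm (exp w) \<le> exp (norm z)" if "w \<in> cball 0 (norm z)" for w :: complex
      using that norm_exp[of w] by (auto intro: order_trans)
  qed (auto intro!: derivative_eq_intros)
  then show ?thesis by (simp add: mult.commute)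
qed

text \<open>The dominating function for differentiation under the integral. With L = |ln x| the
  quotient is at most L exp(\<delta> L); the factor L is absorbed by a second exp(\<delta> L), and
  exp(2 \<delta> L) is one of the two powers of x, depending on the sign of ln x.\<close>

lemma powr_minus_one_quotient_bound:
  fixes w :: complex
  assumes x: "x > 0" and \<delta>: "\<delta> > 0" and w: "w \<noteq> 0" "norm w \<le> \<delta>"
  shows "norm ((of_real x powr w - 1) / w) \<le> (x powr (2 * \<delta>) + x powr (- (2 * \<delta>))) / \<delta>"
proof -
  define L where "L = \<bar>ln x\<bar>"
  have "of_real x powr w = exp (w * of_real (ln x))"
    using x by (simp add: powr_def Ln_of_real)
  then have "norm (of_real x powr w - 1) \<le> norm w * L * exp (norm w * L)"
    using norm_exp_minus_one_le[of "w * of_real (ln x)"] by (simp add: norm_mult L_def)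
  then have "norm ((of_real x powr w - 1) / w) \<le> L * exp (norm w * L)"
    using w by (simp add: norm_divide field_simps)
  also have "\<dots> \<le> L * exp (\<delta> * L)"
    using w by (intro mult_left_mono) (auto simp: L_def intro!: mult_right_mono)
  also have "\<dots> \<le> exp (\<delta> * L) / \<delta> * exp (\<delta> * L)"
  proof (intro mult_right_mono)
    have "\<delta> * L \<le> exp (\<delta> * L)"
      using exp_ge_add_one_self[of "\<delta> * L"] by linarith
    then show "L \<le> exp (\<delta> * L) / \<delta>"
      using \<delta> by (simp add: field_simps)
  qed auto
  also have "\<dots> = exp (2 * \<delta> * L) / \<delta>"
    by (simp flip: exp_add)
  also have "exp (2 * \<delta> * L) \<le> x powr (2 * \<delta>) + x powr (- (2 * \<delta>))"
    using x by (auto simp: powr_def L_def abs_if intro: add_increasing add_increasing2)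
  finally show ?thesis
    using \<delta> by (simp add: divide_right_mono)
qed

text \<open>Differentiation under the integral sign: \<open>q z x\<close> is the difference quotient
  of the integrand, and dominated convergence is applied along an arbitrary sequence tending to
  s.\<close>

lemma mellin_has_field_derivative:
  assumes g: "exp_decay g" and s: "Re s > 0"
  shows "(mellin g has_field_derivative
            (\<integral>x. of_real (ln x) * (of_real x powr (s - 1) * g x) \<partial>halfline)) (at s)"
    and "integrable halfline (\<lambda>x. of_real (ln x) * (of_real x powr (s - 1) * g x))"
proof -
  let ?D = "\<integral>x. of_real (ln x) * (of_real x powr (s - 1) * g x) \<partial>halfline"
  obtain C c where c: "c > 0" and C: "\<And>x. x > 0 \<Longrightarrow> norm (g x) \<le> C * exp (- (c * x))"
    and cont: "continuous_on {0<..} g"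
    using g by (auto simp: exp_decay_def)
  \<comment> \<open>This keeps the smaller exponent Re s - 2 \<delta> = Re s / 2 positive, so
    \<open>W\<close> is integrable at 0.\<close>
  define \<delta> where "\<delta> = Re s / 4"
  have \<delta>: "\<delta> > 0" using s by (simp add: \<delta>_def)
  define q where "q = (\<lambda>z x. of_real x powr (s - 1) * g x * ((of_real x powr (z - s) - 1) / (z - s)))"
  define W where "W = (\<lambda>x. C / \<delta> * (x powr (Re s + 2 * \<delta> - 1) * exp (- (c * x)) +
                            x powr (Re s - 2 * \<delta> - 1) * exp (- (c * x))))"
  have W: "integrable halfline W"
    unfolding W_def
    using has_bochner_integral_Gamma_real[of "Re s + 2 * \<delta>" c]
          has_bochner_integral_Gamma_real[of "Re s - 2 * \<delta>" c] c s
    by (intro integrable_mult_right Bochner_Integration.integrable_add)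
       (auto simp: has_bochner_integral_iff \<delta>_def)
  have bound: "norm (q z x) \<le> W x" if "x > 0" "z \<noteq> s" "norm (z - s) \<le> \<delta>" for z x
  proof -
    have "norm (q z x) = x powr (Re s - 1) * norm (g x) * norm ((of_real x powr (z - s) - 1) / (z - s))"
      using that by (simp add: q_def norm_mult norm_powr_real_powr norm_divide)
    also have "\<dots> \<le> x powr (Re s - 1) * (C * exp (- (c * x))) *
                     ((x powr (2 * \<delta>) + x powr (- (2 * \<delta>))) / \<delta>)"
      using that \<delta> C[OF that(1)] order_trans[OF norm_ge_zero C[OF that(1)]]
      by (intro mult_mono powr_minus_one_quotient_bound mult_nonneg_nonneg)
        (auto simp: zero_le_mult_iff)
    also have "\<dots> = W x"
      using that(1) \<delta> by (simp add: W_def powr_add powr_diff powr_minus field_simps)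
    finally show ?thesis .
  qed
  have meas: "q z \<in> borel_measurable halfline" for z
  proof -
    have "(\<lambda>x. of_real x powr (s - 1) * g x * ((of_real x powr (z - s) - 1) * k))
            \<in> borel_measurable halfline" for k
      by (intro borel_measurable_halfline continuous_intros cont) auto
    from this[of "inverse (z - s)"] show ?thesis
      by (simp add: q_def divide_inverse)
  qed
  have lim: "((\<lambda>z. q z x) \<longlongrightarrow> of_real (ln x) * (of_real x powr (s - 1) * g x)) (at s)" if "x > 0" for x
  proof -
    have "((\<lambda>z. of_real x powr (z - s)) has_field_derivative of_real (ln x)) (at s)"
      using that by (auto simp: powr_def Ln_of_real intro!: derivative_eq_intros)
    then have "((\<lambda>z. (of_real x powr (z - s) - 1) / (z - s)) \<longlongrightarrow> of_real (ln x)) (at s)"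
      using that by (simp add: has_field_derivative_iff)
    then have "((\<lambda>z. of_real x powr (s - 1) * g x * ((of_real x powr (z - s) - 1) / (z - s)))
            \<longlongrightarrow> of_real x powr (s - 1) * g x * of_real (ln x)) (at s)"
      by (rule tendsto_mult_left)
    then show ?thesis by (simp add: q_def mult_ac)
  qed
  have meas': "(\<lambda>x. of_real (ln x) * (of_real x powr (s - 1) * g x)) \<in> borel_measurable halfline"
    by (intro borel_measurable_halfline continuous_intros cont) auto
  have *: "(\<lambda>n. integral\<^sup>L halfline (q (X n))) \<longlonglongrightarrow> ?D \<and>
           integrable halfline (\<lambda>x. of_real (ln x) * (of_real x powr (s - 1) * g x))"
    if X: "\<And>n. X n \<noteq> s" "X \<longlonglongrightarrow> s" for X :: "nat \<Rightarrow> complex"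
  proof -
    from X(2) \<delta> obtain N where N: "\<And>n. n \<ge> N \<Longrightarrow> norm (X n - s) < \<delta>"
      unfolding LIMSEQ_iff by blast
    have XN: "filterlim (\<lambda>n. X (n + N)) (at s) sequentially"
      using X by (intro filterlim_atI LIMSEQ_ignore_initial_segment) auto
    have 1: "AE x in halfline. (\<lambda>n. q (X (n + N)) x) \<longlonglongrightarrow> of_real (ln x) * (of_real x powr (s - 1) * g x)"
      using lim by (intro AE_I2 filterlim_compose[OF _ XN]) (auto simp: space_restrict_space)
    have 2: "AE x in halfline. norm (q (X (n + N)) x) \<le> W x" for n
      using N[of "n + N"] X(1) by (intro AE_I2 bound) (auto simp: space_restrict_space less_imp_le)
    have "(\<lambda>n. integral\<^sup>L halfline (q (X (n + N)))) \<longlonglongrightarrow> ?D"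
      by (rule integral_dominated_convergence[OF meas' meas W 1 2])
    moreover have "integrable halfline (\<lambda>x. of_real (ln x) * (of_real x powr (s - 1) * g x))"
      by (rule integrable_dominated_convergence[OF meas' meas W 1 2])
    ultimately show ?thesis
      using LIMSEQ_offset[of "\<lambda>n. integral\<^sup>L halfline (q (X n))"] by blast
  qed
  have "((\<lambda>z. integral\<^sup>L halfline (q z)) \<longlongrightarrow> ?D) (at s)"
    unfolding tendsto_at_iff_sequentially using * by (auto simp: o_def)
  moreover have "\<forall>\<^sub>F z in at s. integral\<^sup>L halfline (q z) = (mellin g z - mellin g s) / (z - s)"
  proof -
    have "\<forall>\<^sub>F z in at s. Re z > 0"
      using s by (intro eventually_at_in_open'[of "{z. Re z > 0}", simplified] open_halfspace_Re_gt) auto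
    moreover have "\<forall>\<^sub>F z in at s. z \<noteq> s"
      by (auto simp: eventually_at_filter)
    ultimately show ?thesis
    proof eventually_elim
      case (elim z)
      have "(mellin g z - mellin g s) / (z - s) =
            (\<integral>x. (of_real x powr (z - 1) * g x - of_real x powr (s - 1) * g x) / (z - s) \<partial>halfline)"
        using mellin_integrable[OF g elim(1)] mellin_integrable[OF g s]
        by (simp add: mellin_def)
      also have "\<dots> = integral\<^sup>L halfline (q z)"
      proof (rule Bochner_Integration.integral_cong[OF refl])
        fix x assume "x \<in> space halfline"
        then have "x > 0" by (simp add: space_restrict_space)
        then have "complex_of_real x powr (z - 1) = of_real x powr (s - 1) * of_real x powr (z - s)"
          by (simp flip: powr_add)
        then show "(of_real x powr (z - 1) * g x - of_real x powr (s - 1) * g x) / (z - s) = q z x"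
          by (simp add: q_def algebra_simps diff_divide_distrib)
      qed
      finally show ?case by simp
    qed
  qed
  ultimately have "((\<lambda>z. (mellin g z - mellin g s) / (z - s)) \<longlongrightarrow> ?D) (at s)"
    by (rule Lim_transform_eventually)
  then show "(mellin g has_field_derivative ?D) (at s)"
    by (simp add: has_field_derivative_iff)
  \<comment> \<open>Integrability of the limit was obtained per sequence, so one concrete sequence
    has to be exhibited.\<close>
  have "(\<lambda>n. s + of_real (1 / real (Suc n))) \<longlonglongrightarrow> s + of_real 0"
    using lim_1_over_n by (intro tendsto_intros filterlim_compose[OF lim_1_over_n filterlim_Suc])
  moreover have "s + of_real (1 / real (Suc n)) \<noteq> s" for n
    by (simp del: of_nat_Suc)
  ultimately show "integrable halfline (\<lambda>x. of_real (ln x) * (of_real x powr (s - 1) * g x))"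
    using *[of "\<lambda>n. s + of_real (1 / real (Suc n))"] by simp
qed

section \<open>Functions holomorphic and decaying on a half-strip\<close>

definition half_strip :: "real \<Rightarrow> complex set" where
  "half_strip r = {z. - r < Re z \<and> \<bar>Im z\<bar> < r}"

text \<open>The strip extends to the left of 0, so 0 is an interior point and derivatives stay
  bounded up to the end of the half-line. Width, constant and rate are existential, so the strip may
  shrink with each derivative.\<close>

definition strip_decay :: "(complex \<Rightarrow> complex) \<Rightarrow> bool" where
  "strip_decay F \<longleftrightarrow> (\<exists>r>0. \<exists>C. \<exists>c>0. F holomorphic_on half_strip r \<and>
     (\<forall>z\<in>half_strip r. norm (F z) \<le> C * exp (- (c * Re z))))"

lemma open_half_strip: "open (half_strip r)"
proof -
  have "half_strip r = {z. Re z > - r} \<inter> {z. Im z < r} \<inter> {z. Im z > - r}"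
    by (auto simp: half_strip_def)
  then show ?thesis
    by (simp add: open_Int open_halfspace_Re_gt open_halfspace_Im_lt open_halfspace_Im_gt)
qed

lemma of_real_in_half_strip: "r > 0 \<Longrightarrow> x \<ge> 0 \<Longrightarrow> of_real x \<in> half_strip r"
  by (simp add: half_strip_def)

text \<open>Cauchy's inequality on discs of radius r/2 centred in the strip of parameter r/2. On
  such a disc Re w is at least Re z - r/2, so the rate c survives and only the constant
  grows.\<close>

lemma strip_decay_deriv:
  assumes "strip_decay F"
  shows "strip_decay (deriv F)"
proof -
  obtain r C c where r: "r > 0" and c: "c > 0" and hol: "F holomorphic_on half_strip r"
    and C: "\<And>z. z \<in> half_strip r \<Longrightarrow> norm (F z) \<le> C * exp (- (c * Re z))"
    using assms by (auto simp: strip_decay_def)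
  have "C * exp (- (c * Re 0)) \<ge> 0"
    using C[of 0] r by (intro order_trans[OF norm_ge_zero[of "F 0"]]) (auto simp: half_strip_def)
  then have "C \<ge> 0" by simp
  have "norm (deriv F z) \<le> C * exp (c * (r / 2)) / (r / 2) * exp (- (c * Re z))"
    if z: "z \<in> half_strip (r / 2)" for z
  proof -
    have w: "w \<in> half_strip r" "Re w \<ge> Re z - r / 2" if "norm (w - z) \<le> r / 2" for w
      using z that abs_Re_le_cmod[of "w - z"] abs_Im_le_cmod[of "w - z"]
      unfolding half_strip_def by (auto simp: abs_le_iff abs_less_iff)
    have sub: "cball z (r / 2) \<subseteq> half_strip r"
      using w by (auto simp: dist_norm norm_minus_commute)
    have "norm ((deriv ^^ 1) F z) \<le> fact 1 * (C * exp (- (c * (Re z - r / 2)))) / (r / 2) ^ 1"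
    proof (rule Cauchy_inequality)
      show "F holomorphic_on ball z (r / 2)"
        using sub by (intro holomorphic_on_subset[OF hol]) auto
      show "continuous_on (cball z (r / 2)) F"
        using sub by (intro continuous_on_subset[OF holomorphic_on_imp_continuous_on[OF hol]])
      show "norm (F w) \<le> C * exp (- (c * (Re z - r / 2)))" if "norm (z - w) = r / 2" for w
      proof -
        have "norm (F w) \<le> C * exp (- (c * Re w))"
          using w[of w] that by (intro C) (auto simp: norm_minus_commute)
        also have "\<dots> \<le> C * exp (- (c * (Re z - r / 2)))"
          using w[of w] that c \<open>C \<ge> 0\<close> by (intro mult_left_mono) (auto simp: norm_minus_commute)
        finally show ?thesis .
      qed
    qed (use r in auto)
    also have "exp (- (c * (Re z - r / 2))) = exp (c * (r / 2)) * exp (- (c * Re z))"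
      by (simp flip: exp_add add: algebra_simps)
    finally show ?thesis by (simp add: mult_ac)
  qed
  moreover have "deriv F holomorphic_on half_strip (r / 2)"
    using r by (intro holomorphic_on_subset[OF holomorphic_deriv[OF hol open_half_strip]])
      (auto simp: half_strip_def)
  ultimately show ?thesis
    unfolding strip_decay_def using r c
    by (intro exI[of _ "r / 2"] conjI exI[of _ "C * exp (c * (r / 2)) / (r / 2)"] exI[of _ c] ballI) auto
qed

lemma strip_decay_higher_deriv: "strip_decay F \<Longrightarrow> strip_decay ((deriv ^^ n) F)"
  by (induction n) (auto intro: strip_decay_deriv)

lemma strip_decay_imp_exp_decay:
  assumes "strip_decay F"
  shows "exp_decay (\<lambda>x. F (of_real x))"
proof -
  obtain r C c where r: "r > 0" and c: "c > 0" and hol: "F holomorphic_on half_strip r"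
    and C: "\<And>z. z \<in> half_strip r \<Longrightarrow> norm (F z) \<le> C * exp (- (c * Re z))"
    using assms by (auto simp: strip_decay_def)
  have "continuous_on {0<..} (\<lambda>x. F (of_real x))"
    using r by (intro continuous_on_compose2[OF holomorphic_on_imp_continuous_on[OF hol]] continuous_intros)
      (auto intro!: of_real_in_half_strip)
  moreover have "norm (F (of_real x)) \<le> C * exp (- (c * x))" if "x > 0" for x
    using C[OF of_real_in_half_strip[OF r, of x]] that by simp
  ultimately show ?thesis
    using c by (auto simp: exp_decay_def)
qed

lemma strip_decay_has_vector_derivative:
  assumes "strip_decay F" "x \<ge> 0"
  shows "((\<lambda>x. F (of_real x)) has_vector_derivative deriv F (of_real x)) (at x)"
proof -
  obtain r where r: "r > 0" and hol: "F holomorphic_on half_strip r"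
    using assms by (auto simp: strip_decay_def)
  have "(F has_field_derivative deriv F (of_real x)) (at (of_real x))"
    using r assms(2) by (intro holomorphic_derivI[OF hol open_half_strip] of_real_in_half_strip)
  then show ?thesis
    by (rule has_vector_derivative_real_field)
qed

text \<open>Integration by parts with x^s F(x). The boundary term vanishes at 0 because Re s > 0 and
  F is bounded, and at infinity by exponential decay.\<close>

lemma mellin_deriv:
  assumes F: "strip_decay F" and s: "Re s > 0"
  shows "mellin (\<lambda>x. deriv F (of_real x)) (s + 1) = - s * mellin (\<lambda>x. F (of_real x)) s"
proof -
  let ?F = "\<lambda>x::real. F (of_real x)" and ?F' = "\<lambda>x::real. deriv F (of_real x)"
  define f where "f = (\<lambda>x. s * (of_real x powr (s - 1) * ?F x) + of_real x powr (s + 1 - 1) * ?F' x)"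
  have d: "exp_decay ?F" "exp_decay ?F'"
    using F by (auto intro: strip_decay_imp_exp_decay strip_decay_deriv)
  have int: "integrable halfline (\<lambda>x. s * (of_real x powr (s - 1) * ?F x))"
    "integrable halfline (\<lambda>x. of_real x powr (s + 1 - 1) * ?F' x)"
    using mellin_integrable[OF d(1) s] mellin_integrable[OF d(2), of "s + 1"] s by auto
  obtain C c where c: "c > 0" and C: "\<And>x. x > 0 \<Longrightarrow> norm (?F x) \<le> C * exp (- (c * x))"
    using d(1) by (auto simp: exp_decay_def)
  have bound: "norm (of_real x powr s * ?F x) \<le> C * (x powr Re s * exp (- (c * x)))" if "x > 0" for x
    using mult_left_mono[OF C[OF that], of "x powr Re s"] that
    by (simp add: norm_mult norm_powr_real_powr mult_ac)
  have "integral\<^sup>L halfline f = 0 - 0"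
  proof (rule halfline_FTC)
    show "((\<lambda>x. of_real x powr s * ?F x) has_vector_derivative f x) (at x)" if x: "x > 0" for x
    proof -
      have "((\<lambda>z. z powr s) has_field_derivative s * of_real x powr (s - 1)) (at (of_real x))"
        using x by (intro has_field_derivative_powr) auto
      then have "((\<lambda>x. of_real x powr s) has_vector_derivative s * of_real x powr (s - 1)) (at x)"
        by (rule has_vector_derivative_real_field)
      from has_vector_derivative_mult[OF this strip_decay_has_vector_derivative[OF F, of x]]
      show ?thesis
        using x by (simp add: f_def algebra_simps)
    qed
    show "continuous_on {0<..} f"
      using d unfolding f_def by (intro continuous_intros) (auto simp: exp_decay_def)
    show "integrable halfline f"
      using int by (simp add: f_def)
    show "((\<lambda>x. of_real x powr s * ?F x) \<longlongrightarrow> 0) (at_right 0)"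
    proof (rule Lim_null_comparison)
      show "\<forall>\<^sub>F x in at_right 0. norm (of_real x powr s * ?F x) \<le> C * (x powr Re s * exp (- (c * x)))"
        using bound by (intro eventually_mono[OF eventually_at_right_less[of 0]]) auto
      have "((\<lambda>x. x powr Re s * exp (- (c * x))) \<longlongrightarrow> 0) (at_right 0)"
        using s c by real_asymp
      then show "((\<lambda>x. C * (x powr Re s * exp (- (c * x)))) \<longlongrightarrow> 0) (at_right 0)"
        by (rule tendsto_mult_right_zero)
    qed
    show "((\<lambda>x. of_real x powr s * ?F x) \<longlongrightarrow> 0) at_top"
    proof (rule Lim_null_comparison)
      show "\<forall>\<^sub>F x in at_top. norm (of_real x powr s * ?F x) \<le> C * (x powr Re s * exp (- (c * x)))"
        using bound by (intro eventually_mono[OF eventually_gt_at_top[of 0]]) auto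
      have "((\<lambda>x. x powr Re s * exp (- (c * x))) \<longlongrightarrow> 0) at_top"
        using s c by real_asymp
      then show "((\<lambda>x. C * (x powr Re s * exp (- (c * x)))) \<longlongrightarrow> 0) at_top"
        by (rule tendsto_mult_right_zero)
    qed
  qed
  moreover have "integral\<^sup>L halfline f = s * mellin ?F s + mellin ?F' (s + 1)"
    unfolding f_def mellin_def using int by (subst Bochner_Integration.integral_add) auto
  ultimately show ?thesis
    by (simp add: eq_neg_iff_add_eq_0 add.commute)
qed

text \<open>The normalised Mellin transform \<open>(\<integral>x\<^bsup>s-1\<^esup> F x dx) / \<Gamma>(s)\<close>. Integrating by parts \<open>n\<close> times shows
  that it is entire, and that any \<open>n\<close> for which the integral converges gives the same value.\<close>

definition mellin_ext :: "(complex \<Rightarrow> complex) \<Rightarrow> complex \<Rightarrow> complex" where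
  "mellin_ext F s = (let n = nat \<lceil>1 - Re s\<rceil> in
     (-1) ^ n * rGamma (s + of_nat n) * mellin (\<lambda>x. (deriv ^^ n) F (of_real x)) (s + of_nat n))"

text \<open>Raising n by one multiplies the integral by -(s + n) by \<open>mellin_deriv\<close>; the
  recurrence of \<open>rGamma\<close> absorbs s + n and (-1)^n the sign. The n of the definition
  makes Re s + n at least 1, so it is admissible, and two admissible values are joined by steps
  upward from the smaller one.\<close>

lemma mellin_ext_eq:
  assumes F: "strip_decay F" and n: "Re s + real n > 0"
  shows "mellin_ext F s =
    (-1) ^ n * rGamma (s + of_nat n) * mellin (\<lambda>x. (deriv ^^ n) F (of_real x)) (s + of_nat n)"
proof -
  define h where "h = (\<lambda>n. (-1) ^ n * rGamma (s + of_nat n) *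
     mellin (\<lambda>x. (deriv ^^ n) F (of_real x)) (s + of_nat n))"
  have step: "h (Suc k) = h k" if "Re s + real k > 0" for k
  proof -
    have M: "mellin (\<lambda>x. (deriv ^^ Suc k) F (of_real x)) (s + of_nat k + 1) =
          - (s + of_nat k) * mellin (\<lambda>x. (deriv ^^ k) F (of_real x)) (s + of_nat k)"
      using mellin_deriv[OF strip_decay_higher_deriv[OF F, of k], of "s + of_nat k"] that by simp
    have G: "(s + of_nat k) * rGamma (s + of_nat k + 1) = rGamma (s + of_nat k)"
      by (rule rGamma_plus1)
    have "rGamma (s + of_nat k + 1) * mellin (\<lambda>x. (deriv ^^ Suc k) F (of_real x)) (s + of_nat k + 1) =
        - (rGamma (s + of_nat k) * mellin (\<lambda>x. (deriv ^^ k) F (of_real x)) (s + of_nat k))"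
      unfolding M G[symmetric] by (simp only: mult_ac mult_minus_left mult_minus_right)
    then show ?thesis
      by (simp add: h_def add_ac mult.assoc del: funpow.simps)
  qed
  have mono: "h m = h k" if "Re s + real k > 0" "k \<le> m" for k m
    using that(2) by (induction m rule: dec_induct) (use that(1) step in auto)
  let ?m = "nat \<lceil>1 - Re s\<rceil>"
  have m: "Re s + real ?m > 0" by linarith
  have "h ?m = h n"
    using mono[OF m, of n] mono[OF n, of ?m] by (cases "?m \<le> n") auto
  then show ?thesis by (simp add: mellin_ext_def h_def Let_def)
qed

lemma mellin_ext_eq_mellin:
  "strip_decay F \<Longrightarrow> Re s > 0 \<Longrightarrow> mellin_ext F s = rGamma s * mellin (\<lambda>x. F (of_real x)) s"
  using mellin_ext_eq[of F s 0] by simp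

text \<open>The n of the definition jumps with Re s. It can be frozen near a given point, because by
  \<open>mellin_ext_eq\<close> the same n represents the function on the whole half-plane Re z >
  -n.\<close>

lemma mellin_ext_holomorphic:
  assumes F: "strip_decay F"
  shows "mellin_ext F holomorphic_on A"
proof -
  have "mellin_ext F field_differentiable (at s)" for s
  proof -
    define n where "n = nat \<lceil>1 - Re s\<rceil>"
    let ?h = "\<lambda>s. (-1) ^ n * rGamma (s + of_nat n) *
                mellin (\<lambda>x. (deriv ^^ n) F (of_real x)) (s + of_nat n)"
    have n: "Re s + real n > 0" unfolding n_def by linarith
    have "mellin (\<lambda>x. (deriv ^^ n) F (of_real x)) field_differentiable (at (s + of_nat n))"
      using mellin_has_field_derivative(1)[OF strip_decay_imp_exp_decay[OF strip_decay_higher_deriv[OF F, of n]], of "s + of_nat n"] n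
      by (auto simp: field_differentiable_def)
    then have "(\<lambda>s. mellin (\<lambda>x. (deriv ^^ n) F (of_real x)) (s + of_nat n)) field_differentiable (at s)"
      using field_differentiable_compose[of "\<lambda>s. s + of_nat n" s "mellin (\<lambda>x. (deriv ^^ n) F (of_real x))"]
      by (simp add: o_def field_differentiable_add field_differentiable_ident field_differentiable_const)
    moreover have "(\<lambda>s. rGamma (s + of_nat n)) holomorphic_on UNIV"
      by (intro holomorphic_intros)
    then have "(\<lambda>s. rGamma (s + of_nat n)) field_differentiable (at s)"
      by (auto simp: holomorphic_on_def)
    ultimately have "?h field_differentiable (at s)"
      by (intro field_differentiable_mult field_differentiable_const)
    then obtain D where "(?h has_field_derivative D) (at s)"
      by (auto simp: field_differentiable_def)
    then have "(mellin_ext F has_field_derivative D) (at s)"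
    proof (rule has_field_derivative_transform_within_open[where S = "{z. Re z > - real n}"])
      show "?h z = mellin_ext F z" if "z \<in> {z. Re z > - real n}" for z
        using that by (subst mellin_ext_eq[OF F]) auto
    qed (use n in \<open>auto simp: open_halfspace_Re_gt\<close>)
    then show ?thesis by (auto simp: field_differentiable_def)
  qed
  then show ?thesis
    by (auto simp: holomorphic_on_def intro: field_differentiable_at_within)
qed

lemma mellin_ext_holomorphic' [holomorphic_intros]:
  assumes "strip_decay F" "f holomorphic_on A"
  shows "(\<lambda>s. mellin_ext F (f s)) holomorphic_on A"
  using holomorphic_on_compose[OF assms(2) mellin_ext_holomorphic[OF assms(1)]] by (simp add: o_def)

section \<open>Mellin transforms of exponential series\<close>

lemma powr_times_exp_neg_le:
  fixes u \<sigma> :: real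
  assumes "u > 0" "\<sigma> > 0"
  shows "exp (- u) \<le> \<sigma> powr \<sigma> * u powr (- \<sigma>)"
proof -
  \<comment> \<open>The function u^\<sigma> exp(-u) has its maximum at u = \<sigma>; the tangent
    bound for ln at that point gives it, and a factor exp(-\<sigma>) is discarded
    afterwards.\<close>
  have "ln (u / \<sigma>) \<le> u / \<sigma> - 1"
    using assms by (intro ln_le_minus_one) auto
  then have "\<sigma> * ln u \<le> u - \<sigma> + \<sigma> * ln \<sigma>"
    using assms by (simp add: ln_div field_simps)
  then have "- u \<le> \<sigma> * ln \<sigma> + - \<sigma> * ln u"
    using assms by simp
  then have "exp (- u) \<le> exp (\<sigma> * ln \<sigma> + - \<sigma> * ln u)"
    by simp
  then show ?thesis
    using assms by (simp add: powr_def flip: exp_add)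
qed

text \<open>Each exponential contributes Gamma(s) / l^s, and \<open>rGamma s\<close> cancels the
  Gamma factor. The one summability hypothesis supplies both conditions for exchanging sum and
  integral: pointwise through \<open>powr_times_exp_neg_le\<close>, and in L1 norm because the norms
  integrate to Gamma(Re s) times its terms.\<close>

lemma mellin_exp_series:
  fixes c :: "nat \<Rightarrow> complex" and l :: "nat \<Rightarrow> real"
  assumes s: "Re s > 0" and l: "\<And>n. l n > 0"
    and summ: "summable (\<lambda>n. norm (c n) * l n powr (- Re s))"
    and g: "\<And>x. x > 0 \<Longrightarrow> (\<lambda>n. c n * of_real (exp (- (l n * x)))) sums g x"
  shows "(\<lambda>n. c n * of_real (l n) powr (- s)) sums (rGamma s * mellin g s)"
proof -
  define f where "f = (\<lambda>n x. c n * (complex_of_real x powr (s - 1) * of_real (exp (- (l n * x)))))"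
  have f_int: "has_bochner_integral halfline (f n) (c n * (Gamma s / of_real (l n) powr s))" for n
    unfolding f_def by (intro has_bochner_integral_mult_right has_bochner_integral_Gamma s l)
  have norm_f: "has_bochner_integral halfline (\<lambda>x. norm (f n x))
                  (norm (c n) * (Gamma (Re s) / l n powr Re s))" for n
    by (rule has_bochner_integral_cong[THEN iffD1, rotated 3],
        rule has_bochner_integral_mult_right[OF has_bochner_integral_Gamma_real[OF s l]])
       (auto simp: f_def norm_mult space_restrict_space norm_powr_real_powr)
  have 1: "integrable halfline (f n)" for n
    using f_int[of n] by (simp add: has_bochner_integral_iff)
  have 2: "AE x in halfline. summable (\<lambda>n. norm (f n x))"
  proof (rule AE_I2)
    fix x assume "x \<in> space halfline"
    then have x: "x > 0" by (simp add: space_restrict_space)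
    have "summable (\<lambda>n. x powr (Re s - 1) * Re s powr Re s * x powr (- Re s) * (norm (c n) * l n powr (- Re s)))"
      by (intro summable_mult summ)
    then show "summable (\<lambda>n. norm (f n x))"
    proof (rule summable_comparison_test_ev[rotated], intro always_eventually allI)
      fix n
      have "norm (f n x) = x powr (Re s - 1) * (norm (c n) * exp (- (l n * x)))"
        using x by (simp add: f_def norm_mult norm_powr_real_powr)
      also have "\<dots> \<le> x powr (Re s - 1) * (norm (c n) * (Re s powr Re s * (l n * x) powr (- Re s)))"
        using x l[of n] s by (intro mult_left_mono powr_times_exp_neg_le) auto
      also have "\<dots> = x powr (Re s - 1) * Re s powr Re s * x powr (- Re s) * (norm (c n) * l n powr (- Re s))"
        using x l[of n] by (simp add: powr_mult)
      finally show "norm (norm (f n x)) \<le> x powr (Re s - 1) * Re s powr Re s * x powr (- Re s) * (norm (c n) * l n powr (- Re s))"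
        by simp
    qed
  qed
  have 3: "summable (\<lambda>n. \<integral>x. norm (f n x) \<partial>halfline)"
  proof -
    have "(\<integral>x. norm (f n x) \<partial>halfline) = Gamma (Re s) * (norm (c n) * l n powr (- Re s))" for n
      using norm_f[of n] by (simp add: has_bochner_integral_iff powr_minus divide_inverse)
    then show ?thesis using summ by (simp add: summable_mult)
  qed
  have "(\<lambda>n. integral\<^sup>L halfline (f n)) sums (\<integral>x. (\<Sum>n. f n x) \<partial>halfline)"
    by (rule sums_integral[OF 1 2 3])
  moreover have "(\<integral>x. (\<Sum>n. f n x) \<partial>halfline) = mellin g s"
    unfolding mellin_def
  proof (rule Bochner_Integration.integral_cong[OF refl])
    fix x assume "x \<in> space halfline"
    then have x: "x > 0" by (simp add: space_restrict_space)
    have "(\<lambda>n. of_real x powr (s - 1) * (c n * of_real (exp (- (l n * x))))) sums (of_real x powr (s - 1) * g x)"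
      by (intro sums_mult g x)
    then show "(\<Sum>n. f n x) = of_real x powr (s - 1) * g x"
      by (simp add: f_def sums_iff mult_ac)
  qed
  ultimately have "(\<lambda>n. integral\<^sup>L halfline (f n)) sums mellin g s" by simp
  then have "(\<lambda>n. rGamma s * integral\<^sup>L halfline (f n)) sums (rGamma s * mellin g s)"
    by (rule sums_mult)
  moreover have "rGamma s * integral\<^sup>L halfline (f n) = c n * of_real (l n) powr (- s)" for n
  proof -
    have "s \<notin> \<int>\<^sub>\<le>\<^sub>0" using s by (auto elim!: nonpos_Ints_cases)
    then have "rGamma s * Gamma s = 1"
      by (simp add: Gamma_def rGamma_eq_zero_iff)
    then show ?thesis
      using f_int[of n] by (simp add: has_bochner_integral_iff powr_minus divide_inverse mult_ac)
  qed
  ultimately show ?thesis by simp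
qed

subsection \<open>The Hurwitz zeta function\<close>

text \<open>Gives uniqueness for the definite description in \<open>hurwitz_zeta\<close>. After
  removal of singularities the difference vanishes on U, hence everywhere, so f and g agree in a
  punctured neighbourhood of every point. They then share poles and limits, which fix the values: 0
  at a pole, the limit elsewhere.\<close>

lemma nicely_meromorphic_eqI:
  assumes f: "f nicely_meromorphic_on UNIV" and g: "g nicely_meromorphic_on UNIV"
    and U: "open U" "U \<noteq> {}" "\<And>z. z \<in> U \<Longrightarrow> f z = g z"
  shows "f = g"
proof -
  have fm: "f meromorphic_on UNIV" and gm: "g meromorphic_on UNIV"
    using f g by (auto simp: nicely_meromorphic_on_def)
  define d where "d = remove_sings (\<lambda>z. f z - g z)"
  have dm: "(\<lambda>z. f z - g z) meromorphic_on UNIV"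
    using fm gm by (intro meromorphic_intros)
  then have d: "d nicely_meromorphic_on UNIV"
    unfolding d_def by (rule remove_sings_nicely_meromorphic)
  have d_eq: "\<forall>\<^sub>F w in at z. d w = f w - g w" for z
    unfolding d_def using dm
    by (intro eventually_remove_sings_eq_at meromorphic_on_isolated_singularity)
       (auto intro: meromorphic_on_subset)
  obtain u where u: "u \<in> U" using U(2) by auto
  have "\<forall>\<^sub>F w in at u. d w = 0"
    using d_eq[of u] eventually_at_in_open'[OF U(1) u]
    by eventually_elim (use U(3) in auto)
  then have "\<exists>\<^sub>F w in at u. d w = 0"
    by (intro eventually_frequently) auto
  then have d0: "d w = 0" for w
    by (rule frequently_eq_meromorphic_imp_constant[OF _ d]) auto
  have ev: "\<forall>\<^sub>F w in at z. f w = g w" for z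
    using d_eq[of z] by eventually_elim (simp add: d0)
  show ?thesis
  proof
    fix z
    have pole: "is_pole f z \<longleftrightarrow> is_pole g z"
      using ev by (intro is_pole_cong) auto
    show "f z = g z"
    proof (cases "is_pole f z")
      case True
      then have "\<not> (f \<longlongrightarrow> f z) (at z)" "\<not> (g \<longlongrightarrow> g z) (at z)"
        using pole by (auto simp: is_pole_def dest: not_tendsto_and_filterlim_at_infinity[rotated 2])
      then have "f z = 0" "g z = 0"
        using f g unfolding nicely_meromorphic_on_def by blast+
      then show ?thesis by simp
    next
      case False
      then have "(f \<longlongrightarrow> f z) (at z)" "(g \<longlongrightarrow> g z) (at z)"
        using f g pole by (auto simp: nicely_meromorphic_on_def)
      moreover have "(g \<longlongrightarrow> f z) (at z)"
        using \<open>(f \<longlongrightarrow> f z) (at z)\<close> ev by (rule Lim_transform_eventually)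
      ultimately show ?thesis
        using tendsto_unique at_neq_bot by blast
    qed
  qed
qed

text \<open>The generating function of the Bernoulli polynomials at 1 - a. The factor z removes the
  pole of exp(-az) / (1 - exp(-z)) at 0, at the price of a shift from s to s - 1 in the Mellin
  transform.\<close>

definition zeta_kernel :: "real \<Rightarrow> complex \<Rightarrow> complex" where
  "zeta_kernel a z = (if z = 0 then 1 else z * exp (- (of_real a * z)) / (1 - exp (- z)))"

text \<open>The other solutions are nonzero multiples of 2 pi i, too far from the real axis for this
  strip.\<close>

lemma exp_neg_eq_1_half_strip:
  assumes "z \<in> half_strip 2" "exp (- z) = 1"
  shows "z = 0"
proof -
  obtain n :: int where "Re (- z) = 0" "Im (- z) = of_int (2 * n) * pi"
    using assms(2) unfolding exp_eq_1 by blast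
  then have n: "Re z = 0" "Im z = - (of_int (2 * n) * pi)"
    by auto
  have "\<bar>of_int (2 * n) * pi\<bar> < 2"
    using assms(1) n by (simp add: half_strip_def)
  then have "\<bar>of_int n\<bar> * pi < 1"
    by (simp add: abs_mult)
  moreover have "pi > 1" using pi_gt3 by simp
  ultimately have "\<bar>of_int n :: real\<bar> < 1"
    using mult_left_mono[of 1 pi "\<bar>of_int n :: real\<bar>"] by linarith
  then have "n = 0" by linarith
  then show ?thesis using n by (simp add: complex_eq_iff)
qed

lemma zeta_kernel_holomorphic: "zeta_kernel a holomorphic_on half_strip 2"
proof (rule no_isolated_singularity'[where K = "{0}"])
  have *: "(\<lambda>z. z * exp (- (of_real a * z)) / (1 - exp (- z))) holomorphic_on (half_strip 2 - {0})"
    using exp_neg_eq_1_half_strip by (intro holomorphic_intros) auto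
  show "zeta_kernel a holomorphic_on (half_strip 2 - {0})"
    by (rule holomorphic_transform[OF *]) (auto simp: zeta_kernel_def)
  have "filterlim (\<lambda>z::complex. - z) (at 0) (at 0)"
    by (rule filterlim_atI) (auto simp: eventually_at_filter intro!: tendsto_eq_intros)
  then have "((\<lambda>z::complex. (exp (- z) - 1) / (- z)) \<longlongrightarrow> 1) (at 0)"
    by (rule filterlim_compose[OF lim_exp_minus_1])
  then have "((\<lambda>z::complex. exp (- (of_real a * z)) / ((exp (- z) - 1) / (- z))) \<longlongrightarrow> exp (- (of_real a * 0)) / 1) (at 0)"
    by (intro tendsto_intros) auto
  then have "(zeta_kernel a \<longlongrightarrow> 1) (at 0)"
    by (rule filterlim_cong[THEN iffD1, rotated 3])
       (auto simp: eventually_at_filter zeta_kernel_def divide_simps algebra_simps)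
  then show "(zeta_kernel a \<longlongrightarrow> zeta_kernel a z) (at z within half_strip 2)" if "z \<in> {0}" for z
    using that by (auto simp: zeta_kernel_def intro: tendsto_within_subset)
qed (auto simp: open_half_strip)

lemma strip_decay_zeta_kernel:
  assumes a: "a > 0"
  shows "strip_decay (zeta_kernel a)"
proof -
  define K :: "complex set" where "K = cbox (Complex (-1) (-1)) (Complex 1 1)"
  have "K \<subseteq> half_strip 2"
    by (auto simp: K_def half_strip_def in_cbox_complex_iff)
  then have "continuous_on K (zeta_kernel a)"
    using holomorphic_on_imp_continuous_on[OF zeta_kernel_holomorphic] continuous_on_subset by blast
  then have "compact (zeta_kernel a ` K)"
    by (rule compact_continuous_image) (auto simp: K_def)
  then have "bounded (zeta_kernel a ` K)"
    by (rule compact_imp_bounded)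
  then obtain B where B: "B > 0" "\<And>z. z \<in> K \<Longrightarrow> norm (zeta_kernel a z) \<le> B"
    by (auto simp: bounded_pos)
  \<comment> \<open>The first summand serves the compact square that contains the part with Re z <=
    1, the second the tail. The rate a/2 in place of a leaves a factor exp(a/2 * Re z) to absorb the
    linear growth of z.\<close>
  define C where "C = B * exp (a / 2) + 8 / a"
  have "norm (zeta_kernel a z) \<le> C * exp (- (a / 2 * Re z))" if z: "z \<in> half_strip 1" for z
  proof (cases "Re z \<le> 1")
    case True
    then have "z \<in> K"
      using z by (auto simp: K_def half_strip_def in_cbox_complex_iff)
    then have "norm (zeta_kernel a z) \<le> B"
      by (rule B(2))
    also have "B \<le> B * (exp (a / 2) * exp (- (a / 2 * Re z)))"
    proof -
      have "0 \<le> a / 2 - a / 2 * Re z"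
        using True a by (simp add: mult_le_cancel_left1 divide_simps)
      then have "1 \<le> exp (a / 2 - a / 2 * Re z)" by simp
      then show ?thesis using B(1) by (simp flip: exp_add)
    qed
    also have "\<dots> \<le> C * exp (- (a / 2 * Re z))"
      using a by (simp add: C_def algebra_simps)
    finally show ?thesis .
  next
    case False
    define t where "t = Re z"
    have t: "t > 1" "z \<noteq> 0" using False by (auto simp: t_def)
    have "1 / 2 \<le> 1 - exp (- t)"
    proof -
      have "2 \<le> exp t" using exp_ge_add_one_self[of t] t by linarith
      then show ?thesis by (simp add: exp_minus divide_simps)
    qed
    also have "\<dots> \<le> norm (1 - exp (- z))"
      using norm_triangle_ineq2[of 1 "exp (- z)"] by (simp add: t_def)
    finally have 1: "1 / 2 \<le> norm (1 - exp (- z))" .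
    have "norm z \<le> \<bar>Re z\<bar> + \<bar>Im z\<bar>" by (rule cmod_le)
    also have "\<dots> \<le> 2 * t" using z t by (auto simp: half_strip_def t_def)
    finally have 2: "norm z \<le> 2 * t" .
    have "a / 2 * t \<le> exp (a / 2 * t)"
      using exp_ge_add_one_self[of "a / 2 * t"] by linarith
    then have 3: "2 * t \<le> 4 / a * exp (a / 2 * t)"
      using a by (simp add: field_simps)
    have "norm (zeta_kernel a z) = norm z * exp (- (a * t)) / norm (1 - exp (- z))"
      using t by (simp add: zeta_kernel_def norm_mult norm_divide t_def)
    also have "\<dots> \<le> (4 / a * exp (a / 2 * t)) * exp (- (a * t)) / (1 / 2)"
      using 1 2 3 a by (intro frac_le mult_right_mono) auto
    also have "\<dots> = 8 / a * exp (- (a / 2 * t))"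
      by (simp flip: exp_add add: field_simps)
    also have "\<dots> \<le> C * exp (- (a / 2 * t))"
      using B by (intro mult_right_mono) (auto simp: C_def)
    finally show ?thesis by (simp add: t_def)
  qed
  moreover have "zeta_kernel a holomorphic_on half_strip 1"
    by (rule holomorphic_on_subset[OF zeta_kernel_holomorphic]) (auto simp: half_strip_def)
  ultimately show ?thesis
    unfolding strip_decay_def using a by (intro exI[of _ 1] conjI exI[of _ C] exI[of _ "a / 2"]) auto
qed

lemma summable_shifted_powr:
  assumes "a > 0" "\<sigma> > 1"
  shows "summable (\<lambda>n. (real n + a) powr (- \<sigma>))"
proof (rule summable_comparison_test_ev)
  show "summable (\<lambda>n. real n powr (- \<sigma>))"
    using assms by (simp add: summable_real_powr_iff)
  show "\<forall>\<^sub>F n in sequentially. norm ((real n + a) powr (- \<sigma>)) \<le> real n powr (- \<sigma>)"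
    using eventually_gt_at_top[of 0] by eventually_elim (use assms in \<open>auto intro!: powr_mono2'\<close>)
qed

text \<open>A geometric expansion of 1 / (1 - exp(-x)). Moving one factor x into the kernel lowers s
  by one, and \<open>rGamma (s - 1)\<close> = (s - 1) \<open>rGamma s\<close> accounts for the
  division by s - 1.\<close>

lemma hurwitz_series:
  assumes a: "a > 0" and s: "Re s > 1"
  shows "(\<lambda>n. of_real (real n + a) powr (- s)) sums (mellin_ext (zeta_kernel a) (s - 1) / (s - 1))"
proof -
  define g where "g = (\<lambda>x. of_real (exp (- (a * x)) / (1 - exp (- x))) :: complex)"
  have "(\<lambda>n. 1 * of_real (real n + a) powr (- s)) sums (rGamma s * mellin g s)"
  proof (rule mellin_exp_series)
    show "summable (\<lambda>n. norm (1 :: complex) * (real n + a) powr (- Re s))"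
      using summable_shifted_powr[OF a s] by simp
    show "(\<lambda>n. 1 * complex_of_real (exp (- ((real n + a) * x)))) sums g x" if "x > 0" for x
    proof -
      have "(\<lambda>n. exp (- (a * x)) * exp (- x) ^ n) sums (exp (- (a * x)) * (1 / (1 - exp (- x))))"
        using that by (intro sums_mult geometric_sums) auto
      then have "(\<lambda>n. exp (- ((real n + a) * x))) sums (exp (- (a * x)) / (1 - exp (- x)))"
        by (simp flip: exp_of_nat_mult exp_add add: algebra_simps)
      then show ?thesis
        unfolding g_def mult_1 by (rule sums_of_real)
    qed
  qed (use a s in auto)
  moreover have "mellin (\<lambda>x. zeta_kernel a (of_real x)) (s - 1) = mellin g s"
    unfolding mellin_def
  proof (rule Bochner_Integration.integral_cong[OF refl])
    fix x assume "x \<in> space halfline"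
    then have x: "x > 0" by (simp add: space_restrict_space)
    then have "complex_of_real x powr (s - 1) = of_real x powr (s - 1 - 1) * of_real x"
      by (simp add: powr_diff power2_eq_square)
    then show "of_real x powr (s - 1 - 1) * zeta_kernel a (of_real x) = of_real x powr (s - 1) * g x"
      using x by (simp add: g_def zeta_kernel_def flip: exp_of_real)
  qed
  moreover have "rGamma (s - 1) = (s - 1) * rGamma s"
    using rGamma_plus1[of "s - 1"] by simp
  moreover have "s \<noteq> 1" using s by auto
  ultimately show ?thesis
    using mellin_ext_eq_mellin[OF strip_decay_zeta_kernel[OF a], of "s - 1"] s by simp
qed

text \<open>The quotient is meromorphic and equals the series for Re s > 1;
  \<open>remove_sings\<close> normalises it at s = 1 without changing it elsewhere. The result meets
  the description in \<open>hurwitz_zeta\<close> and is the only such function by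
  \<open>nicely_meromorphic_eqI\<close>.\<close>

lemma hurwitz_zeta_eq:
  assumes a: "a > 0" and s: "s \<noteq> 1"
  shows "hurwitz_zeta s a = mellin_ext (zeta_kernel a) (s - 1) / (s - 1)"
proof -
  define g where "g = (\<lambda>s. mellin_ext (zeta_kernel a) (s - 1) / (s - 1))"
  have hol: "(\<lambda>s. mellin_ext (zeta_kernel a) (s - 1)) holomorphic_on A" for A
    by (intro holomorphic_intros strip_decay_zeta_kernel a)
  have "g holomorphic_on - {1}"
    unfolding g_def by (intro holomorphic_intros hol) auto
  then have g_an: "g analytic_on {z}" if "z \<noteq> 1" for z
    using that by (auto simp: analytic_at intro!: exI[of _ "- {1}"])
  have "(\<lambda>s. mellin_ext (zeta_kernel a) (s - 1)) analytic_on UNIV"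
    using hol by (simp add: analytic_on_open)
  then have "g meromorphic_on UNIV"
    unfolding g_def by (intro meromorphic_intros analytic_on_imp_meromorphic_on)
  then have nice: "remove_sings g nicely_meromorphic_on UNIV"
    by (rule remove_sings_nicely_meromorphic)
  have eq: "remove_sings g z = g z" if "z \<noteq> 1" for z
    using g_an[OF that] by simp
  have ser: "remove_sings g z = (\<Sum>n. of_real (real n + a) powr (- z))" if "Re z > 1" for z
  proof -
    have "z \<noteq> 1" using that by auto
    then show ?thesis
      using hurwitz_series[OF a that] eq[of z] by (simp add: g_def sums_iff)
  qed
  have "(THE f. f nicely_meromorphic_on UNIV \<and>
             (\<forall>z. Re z > 1 \<longrightarrow> f z = (\<Sum>n. of_real (real n + a) powr (-z)))) = remove_sings g"
  proof (rule the_equality)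
    show "f = remove_sings g" if "f nicely_meromorphic_on UNIV \<and>
             (\<forall>z. Re z > 1 \<longrightarrow> f z = (\<Sum>n. of_real (real n + a) powr (-z)))" for f
    proof (rule nicely_meromorphic_eqI)
      show "open {z. Re z > 1}" by (rule open_halfspace_Re_gt)
      have "2 \<in> {z. Re z > 1}" by simp
      then show "{z. Re z > 1} \<noteq> {}" by blast
    qed (use that nice ser in auto)
  qed (use nice ser in auto)
  then show ?thesis
    using eq[OF s] by (simp add: hurwitz_zeta_def g_def)
qed

text \<open>This equals exp(-az) (1 - exp(-z/2)) / (1 - exp(-z)), the kernel belonging to zeta(s,a)
  - zeta(s,a+1/2). It is regular at 0, which is why the difference has no pole at s = 1.\<close>

definition eta_kernel :: "real \<Rightarrow> complex \<Rightarrow> complex" where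
  "eta_kernel a z = exp (- (of_real a * z)) / (1 + exp (- (z / 2)))"

lemma strip_decay_eta_kernel:
  assumes a: "a > 0"
  shows "strip_decay (eta_kernel a)"
proof -
  have half: "norm (1 + exp (- (z / 2))) \<ge> 1" if "z \<in> half_strip 1" for z
  proof -
    \<comment> \<open>Hence exp(-z/2) has nonnegative real part and the denominator of the kernel
      stays at distance at least 1 from 0.\<close>
    have "cos (Im z / 2) \<ge> 0"
      using that pi_gt3 by (intro cos_ge_zero) (auto simp: half_strip_def)
    then have "Re (1 + exp (- (z / 2))) \<ge> 1"
      by (simp add: Re_exp)
    then show ?thesis
      using complex_Re_le_cmod order_trans by blast
  qed
  have "eta_kernel a holomorphic_on half_strip 1"
  proof -
    have "1 + exp (- (z / 2)) \<noteq> 0" if "z \<in> half_strip 1" for z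
      using half[OF that] by auto
    then show ?thesis
      unfolding eta_kernel_def by (intro holomorphic_intros) auto
  qed
  moreover have "norm (eta_kernel a z) \<le> 1 * exp (- (a * Re z))" if "z \<in> half_strip 1" for z
    using half[OF that] by (simp add: eta_kernel_def norm_divide divide_le_eq mult_le_cancel_left1)
  ultimately show ?thesis
    unfolding strip_decay_def using a by (intro exI[of _ 1] conjI exI[of _ 1] exI[of _ a]) auto
qed

lemma eta_series:
  assumes a: "a > 0" and s: "Re s > 1"
  shows "(\<lambda>n. (-1) ^ n * of_real (real n / 2 + a) powr (- s)) sums mellin_ext (eta_kernel a) s"
proof -
  have "(\<lambda>n. (-1) ^ n * of_real (real n / 2 + a) powr (- s)) sums
          (rGamma s * mellin (\<lambda>x. eta_kernel a (of_real x)) s)"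
  proof (rule mellin_exp_series)
    have "summable (\<lambda>n. (1 / 2) powr (- Re s) * (real n + 2 * a) powr (- Re s))"
      using summable_shifted_powr[of "2 * a" "Re s"] a s by (intro summable_mult) auto
    also have "(\<lambda>n. (1 / 2) powr (- Re s) * (real n + 2 * a) powr (- Re s)) =
               (\<lambda>n. (real n / 2 + a) powr (- Re s))"
      using a by (subst powr_mult[symmetric]) (auto simp: field_simps)
    finally show "summable (\<lambda>n. norm ((- 1 :: complex) ^ n) * (real n / 2 + a) powr (- Re s))"
      by (simp add: norm_power)
    show "(\<lambda>n. (-1) ^ n * complex_of_real (exp (- ((real n / 2 + a) * x)))) sums eta_kernel a (of_real x)"
      if "x > 0" for x
    proof -
      have "(\<lambda>n. exp (- (a * x)) * (- exp (- (x / 2))) ^ n) sums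
              (exp (- (a * x)) * (1 / (1 - (- exp (- (x / 2))))))"
        using that by (intro sums_mult geometric_sums) auto
      moreover have "exp (- (a * x)) * (- exp (- (x / 2))) ^ n = (-1) ^ n * exp (- ((real n / 2 + a) * x))" for n
        by (subst power_minus) (simp flip: exp_of_nat_mult exp_add add: algebra_simps)
      ultimately have "(\<lambda>n. (-1) ^ n * exp (- ((real n / 2 + a) * x))) sums
                         (exp (- (a * x)) / (1 + exp (- (x / 2))))"
        by simp
      from sums_of_real[OF this, where 'a = complex] show ?thesis
        by (simp add: eta_kernel_def flip: exp_of_real)
    qed
  qed (use a s in \<open>auto simp: add_nonneg_pos\<close>)
  then show ?thesis
    using mellin_ext_eq_mellin[OF strip_decay_eta_kernel[OF a], of s] s by simp
qed

text \<open>For Re s > 1 the terms 2n and 2n + 1 of the alternating series are the n-th terms of the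
  two Hurwitz series. The rest is continuation over the plane without 1, which is connected.\<close>

lemma hurwitz_zeta_diff_half:
  assumes a: "a > 0" and s: "s \<noteq> 1"
  shows "hurwitz_zeta s a - hurwitz_zeta s (a + 1 / 2) = mellin_ext (eta_kernel a) s"
proof -
  let ?Z = "\<lambda>a s. mellin_ext (zeta_kernel a) (s - 1) / (s - 1)"
  have hol: "?Z b holomorphic_on - {1}" if "b > 0" for b
    by (intro holomorphic_intros strip_decay_zeta_kernel that) auto
  have "?Z a s - ?Z (a + 1 / 2) s = mellin_ext (eta_kernel a) s"
  proof (rule analytic_continuation_open[where s = "{z. Re z > 1}" and s' = "- {1}"
          and f = "\<lambda>s. ?Z a s - ?Z (a + 1 / 2) s" and g = "mellin_ext (eta_kernel a)"])
    have "2 \<in> {z. Re z > 1}" by simp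
    then show "{z. Re z > 1} \<noteq> {}" by blast
    show "connected (- {1 :: complex})"
      by (rule connected_punctured_universe) simp
    show "(\<lambda>s. ?Z a s - ?Z (a + 1 / 2) s) holomorphic_on - {1}"
      using a by (intro holomorphic_on_diff hol) auto
    show "mellin_ext (eta_kernel a) holomorphic_on - {1}"
      by (rule mellin_ext_holomorphic[OF strip_decay_eta_kernel[OF a]])
    show "?Z a z - ?Z (a + 1 / 2) z = mellin_ext (eta_kernel a) z" if "z \<in> {z. Re z > 1}" for z
    proof -
      have z: "Re z > 1" using that by simp
      have "(\<lambda>n. of_real (real n + a) powr (- z) - of_real (real n + (a + 1 / 2)) powr (- z)) sums
              (?Z a z - ?Z (a + 1 / 2) z)"
        using a z by (intro sums_diff hurwitz_series) auto
      moreover have "(\<lambda>n. \<Sum>k=n*2..<n*2+2. (-1) ^ k * of_real (real k / 2 + a) powr (- z)) sums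
                       mellin_ext (eta_kernel a) z"
        by (rule sums_group[OF eta_series[OF a z]]) auto
      moreover have "(\<Sum>k=n*2..<n*2+2. (-1) ^ k * of_real (real k / 2 + a) powr (- z)) =
             of_real (real n + a) powr (- z) - of_real (real n + (a + 1 / 2)) powr (- z)" for n
      proof -
        have "{n*2..<n*2+2} = {n*2, Suc (n*2)}" by auto
        then show ?thesis by (simp add: algebra_simps add_divide_distrib)
      qed
      ultimately show ?thesis
        by (simp add: sums_iff)
    qed
  qed (use s in \<open>auto simp: open_halfspace_Re_gt\<close>)
  then show ?thesis
    using hurwitz_zeta_eq[OF a s] hurwitz_zeta_eq[of "a + 1 / 2" s] a s by simp
qed

text \<open>Every bracket in \<open>sech_F\<close> has arguments that differ by 1/2. Since the
  difference of the zeta functions continues to an entire function, the limit prescribed at s = 1 is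
  just the value there of its continuous derivative.\<close>

lemma zeta_bracket_eq:
  assumes a: "a > 0"
  shows "zeta_bracket s a (a + 1 / 2) = deriv (mellin_ext (eta_kernel a)) s"
proof -
  let ?D = "mellin_ext (eta_kernel a)"
  have D: "?D holomorphic_on UNIV"
    by (rule mellin_ext_holomorphic[OF strip_decay_eta_kernel[OF a]])
  have diff: "(\<lambda>z. hurwitz_zeta z b) field_differentiable (at z)" if "b > 0" "z \<noteq> 1" for b z
  proof -
    have "(\<lambda>z. mellin_ext (zeta_kernel b) (z - 1) / (z - 1)) holomorphic_on - {1}"
      by (intro holomorphic_intros strip_decay_zeta_kernel that) auto
    then have "(\<lambda>z. hurwitz_zeta z b) holomorphic_on - {1}"
      by (rule holomorphic_transform) (auto simp: hurwitz_zeta_eq that)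
    then show ?thesis
      using that(2) by (intro holomorphic_on_imp_differentiable_at[of _ "- {1}"]) auto
  qed
  have eq: "hurwitz_zeta_deriv z a - hurwitz_zeta_deriv z (a + 1 / 2) = deriv ?D z" if "z \<noteq> 1" for z
  proof -
    have "hurwitz_zeta_deriv z a - hurwitz_zeta_deriv z (a + 1 / 2) =
          deriv (\<lambda>z. hurwitz_zeta z a - hurwitz_zeta z (a + 1 / 2)) z"
      unfolding hurwitz_zeta_deriv_def using diff that a by (intro deriv_diff[symmetric]) auto
    also have "\<dots> = deriv ?D z"
    proof (rule deriv_cong_ev)
      have "\<forall>\<^sub>F w in nhds z. w \<in> - {1}"
        using that by (intro eventually_nhds_in_open) auto
      then show "\<forall>\<^sub>F w in nhds z. hurwitz_zeta w a - hurwitz_zeta w (a + 1 / 2) = ?D w"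
        by eventually_elim (use hurwitz_zeta_diff_half[OF a] in auto)
    qed auto
    finally show ?thesis .
  qed
  show ?thesis
  proof (cases "s = 1")
    case True
    have "deriv ?D holomorphic_on UNIV"
      using D by (intro holomorphic_deriv) auto
    then have "(deriv ?D \<longlongrightarrow> deriv ?D 1) (at 1)"
      using holomorphic_on_imp_continuous_on by (auto simp: continuous_on_def)
    then have "((\<lambda>z. hurwitz_zeta_deriv z a - hurwitz_zeta_deriv z (a + 1 / 2)) \<longlongrightarrow> deriv ?D 1) (at 1)"
      by (rule Lim_transform_eventually) (auto simp: eventually_at_filter eq)
    then have "Lim (at 1) (\<lambda>z. hurwitz_zeta_deriv z a - hurwitz_zeta_deriv z (a + 1 / 2)) = deriv ?D 1"
      by (intro tendsto_Lim) auto
    then show ?thesis using True by (simp add: zeta_bracket_def)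
  qed (simp add: zeta_bracket_def eq)
qed

subsection \<open>The integral with Catalan's constant\<close>

text \<open>In the difference of the two defining series the terms 1/(k+1) and Euler's constant
  cancel.\<close>

lemma Digamma_diff_sums:
  fixes z w :: complex
  assumes "z \<noteq> 0" "w \<noteq> 0"
  shows "(\<lambda>k. inverse (w + of_nat k) - inverse (z + of_nat k)) sums (Digamma z - Digamma w)"
proof -
  have "(\<lambda>k. (inverse (of_nat (Suc k)) - inverse (z + of_nat k)) -
             (inverse (of_nat (Suc k)) - inverse (w + of_nat k))) sums
        ((\<Sum>k. inverse (of_nat (Suc k)) - inverse (z + of_nat k)) -
         (\<Sum>k. inverse (of_nat (Suc k)) - inverse (w + of_nat k)))"
    by (intro sums_diff summable_sums summable_Digamma assms)
  then show ?thesis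
    by (simp add: Digamma_def algebra_simps)
qed

lemma Re_pos_not_nonpos_Int: "Re z > 0 \<Longrightarrow> z \<notin> \<int>\<^sub>\<le>\<^sub>0"
  by (auto elim!: nonpos_Ints_cases)

text \<open>Obtained by differentiating \<open>rGamma z * rGamma (1 - z)\<close> = sin(pi z) / pi in
  two ways.\<close>

lemma Digamma_reflection:
  fixes z :: complex
  assumes "0 < Re z" "Re z < 1"
  shows "sin (of_real pi * z) * (Digamma (1 - z) - Digamma z) = of_real pi * cos (of_real pi * z)"
proof -
  have ni: "z \<notin> \<int>\<^sub>\<le>\<^sub>0" "1 - z \<notin> \<int>\<^sub>\<le>\<^sub>0"
    using assms by (auto intro!: Re_pos_not_nonpos_Int)
  have "((\<lambda>z. rGamma z * rGamma (1 - z)) has_field_derivative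
          rGamma z * rGamma (1 - z) * (Digamma (1 - z) - Digamma z)) (at z)"
    using ni by (auto intro!: derivative_eq_intros simp: algebra_simps)
  then have "((\<lambda>z. sin (of_real pi * z) / of_real pi) has_field_derivative
          sin (of_real pi * z) / of_real pi * (Digamma (1 - z) - Digamma z)) (at z)"
    by (simp add: rGamma_reflection_complex)
  moreover have "((\<lambda>z. sin (of_real pi * z) / of_real pi) has_field_derivative cos (of_real pi * z)) (at z)"
    by (auto intro!: derivative_eq_intros)
  ultimately have "sin (of_real pi * z) / of_real pi * (Digamma (1 - z) - Digamma z) = cos (of_real pi * z)"
    by (rule DERIV_unique)
  then show ?thesis
    by (simp add: field_simps)
qed

text \<open>The poles of \<open>sech\<close> are \<open>\<plusminus>i sech_pole n\<close>. Consecutive terms of the partial fraction expansion are paired,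
  which makes the series converge absolutely.\<close>

definition sech_pole :: "nat \<Rightarrow> real" where
  "sech_pole n = pi * (real n + 1 / 2)"

lemma sech_pole_pos: "sech_pole n > 0"
  by (simp add: sech_pole_def add_nonneg_pos)

lemma sech_partial_fractions:
  "(\<lambda>k. 2 * sech_pole (2 * k) / ((sech_pole (2 * k))\<^sup>2 + x\<^sup>2) -
        2 * sech_pole (2 * k + 1) / ((sech_pole (2 * k + 1))\<^sup>2 + x\<^sup>2)) sums sech x"
proof -
  \<comment> \<open>Chosen so that sin(pi z) = cosh x, which makes the reciprocal of the sine in the
    reflection formula a \<open>sech\<close>.\<close>
  define z where "z = Complex (1 / 2) (x / pi)"
  define A where "A = of_real pi * (z / 2)"
  define T where "T = (\<lambda>n. complex_of_real (2 * pi * sech_pole n / ((sech_pole n)\<^sup>2 + x\<^sup>2)))"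
  have Re_z: "Re z = 1 / 2" by (simp add: z_def)
  have "sin (2 * A) = cos (\<i> * of_real x)"
  proof -
    have "2 * A = of_real pi / 2 + \<i> * of_real x"
      by (simp add: A_def z_def complex_eq_iff)
    then show ?thesis by (simp add: sin_add)
  qed
  also have "\<dots> = of_real (cosh x)"
    by (simp add: cosh_def scaleR_conv_of_real cos_exp_eq flip: exp_of_real)
  finally have sin2A: "sin (2 * A) = of_real (cosh x)" .
  define S1 where "S1 = Digamma (1 - z / 2) - Digamma (z / 2)"
  define S2 where "S2 = Digamma ((1 + z) / 2) - Digamma ((1 - z) / 2)"
  have S1: "sin A * S1 = of_real pi * cos A"
    unfolding S1_def A_def by (rule Digamma_reflection) (auto simp: Re_z)
  have "sin (of_real pi * ((1 - z) / 2)) * (Digamma (1 - (1 - z) / 2) - Digamma ((1 - z) / 2)) =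
        of_real pi * cos (of_real pi * ((1 - z) / 2))"
    by (rule Digamma_reflection) (auto simp: Re_z)
  moreover have e: "of_real pi * ((1 - z) / 2) = of_real pi / 2 - A" "1 - (1 - z) / 2 = (1 + z) / 2"
    by (simp_all add: A_def field_simps)
  ultimately have "sin (of_real pi / 2 - A) * S2 = of_real pi * cos (of_real pi / 2 - A)"
    unfolding S2_def e by blast
  then have S2: "cos A * S2 = of_real pi * sin A"
    unfolding sin_diff cos_diff by simp
  \<comment> \<open>Morally S1 = pi cot A and S2 = pi tan A, with sum 2 pi / sin(2A). Working with
    products avoids any division by sin A or cos A.\<close>
  have "of_real (cosh x) * (S1 + S2) = 2 * (cos A * (sin A * S1) + sin A * (cos A * S2))"
    unfolding sin2A[symmetric] sin_double by (simp add: algebra_simps)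
  also have "\<dots> = 2 * of_real pi * ((cos A)\<^sup>2 + (sin A)\<^sup>2)"
    unfolding S1 S2 by (simp only: algebra_simps power2_eq_square)
  finally have S: "S1 + S2 = of_real (2 * pi / cosh x)"
    by (simp add: field_simps)
  have "(\<lambda>k. (inverse (z / 2 + of_nat k) - inverse ((1 + z) / 2 + of_nat k)) +
             (inverse ((1 - z) / 2 + of_nat k) - inverse ((1 - z / 2) + of_nat k))) sums
        ((Digamma ((1 + z) / 2) - Digamma (z / 2)) + (Digamma (1 - z / 2) - Digamma ((1 - z) / 2)))"
    by (intro sums_add Digamma_diff_sums) (auto simp: complex_eq_iff z_def)
  also have "(Digamma ((1 + z) / 2) - Digamma (z / 2)) + (Digamma (1 - z / 2) - Digamma ((1 - z) / 2)) = S1 + S2"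
    by (simp add: S1_def S2_def)
  also have "(\<lambda>k. (inverse (z / 2 + of_nat k) - inverse ((1 + z) / 2 + of_nat k)) +
             (inverse ((1 - z) / 2 + of_nat k) - inverse ((1 - z / 2) + of_nat k))) =
             (\<lambda>k. 2 * (T (2 * k) - T (2 * k + 1)))"
  proof
    fix k
    \<comment> \<open>\<open>T n\<close> is pi times the n-th term of the expansion without sign;
      the two summands are conjugate, b + y and b - y having real part n + 1/2.\<close>
    have T: "T n = inverse (z + of_nat n) + inverse (1 - z + of_nat n)" for n
    proof -
      define b where "b = complex_of_real (real n + 1 / 2)"
      define y where "y = \<i> * complex_of_real (x / pi)"
      have zy: "z + of_nat n = b + y" "1 - z + of_nat n = b - y"
        by (simp_all add: z_def b_def y_def complex_eq_iff)
      have nz: "b + y \<noteq> 0" "b - y \<noteq> 0"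
        by (auto simp: b_def y_def complex_eq_iff)
      have "inverse (b + y) + inverse (b - y) = 2 * b / ((b + y) * (b - y))"
        using nz by (simp add: field_simps)
      also have "(b + y) * (b - y) = of_real ((real n + 1 / 2)\<^sup>2 + (x / pi)\<^sup>2)"
        by (simp add: b_def y_def algebra_simps power2_eq_square)
      also have "2 * b / of_real ((real n + 1 / 2)\<^sup>2 + (x / pi)\<^sup>2) =
                 of_real (2 * (real n + 1 / 2) / ((real n + 1 / 2)\<^sup>2 + (x / pi)\<^sup>2))"
        by (simp add: b_def)
      also have "2 * (real n + 1 / 2) / ((real n + 1 / 2)\<^sup>2 + (x / pi)\<^sup>2) =
                 2 * pi * sech_pole n / ((sech_pole n)\<^sup>2 + x\<^sup>2)"
      proof -
        have "(sech_pole n)\<^sup>2 + x\<^sup>2 = pi\<^sup>2 * ((real n + 1 / 2)\<^sup>2 + (x / pi)\<^sup>2)"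
          unfolding sech_pole_def power_mult_distrib distrib_left[of "pi\<^sup>2"] by (simp add: power_divide)
        then show ?thesis
          by (simp add: sech_pole_def power2_eq_square)
      qed
      finally show ?thesis unfolding T_def zy by simp
    qed
    have e: "inverse (w / 2) = 2 * inverse w" for w :: complex
      by (subst inverse_divide) (rule divide_inverse)
    have "z / 2 + of_nat k = (z + of_nat (2 * k)) / 2" "(1 + z) / 2 + of_nat k = (z + of_nat (2 * k + 1)) / 2"
      "(1 - z) / 2 + of_nat k = (1 - z + of_nat (2 * k)) / 2"
      "(1 - z / 2) + of_nat k = (1 - z + of_nat (2 * k + 1)) / 2"
      by (simp_all add: field_simps)
    then show "(inverse (z / 2 + of_nat k) - inverse ((1 + z) / 2 + of_nat k)) +
             (inverse ((1 - z) / 2 + of_nat k) - inverse ((1 - z / 2) + of_nat k)) =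
             2 * (T (2 * k) - T (2 * k + 1))"
      unfolding T by (simp only: e) (simp add: algebra_simps)
  qed
  finally have "(\<lambda>k. 2 * (T (2 * k) - T (2 * k + 1))) sums of_real (2 * pi / cosh x)"
    unfolding S .
  moreover have pi_cancel: "complex_of_real pi * (inverse (complex_of_real pi) * w) = w" for w
    by (simp flip: mult.assoc)
  ultimately have "(\<lambda>k. complex_of_real (inverse (2 * pi)) * (2 * (T (2 * k) - T (2 * k + 1)))) sums
               (complex_of_real (inverse (2 * pi)) * of_real (2 * pi / cosh x))"
    by (intro sums_mult)
  also have "(\<lambda>k. complex_of_real (inverse (2 * pi)) * (2 * (T (2 * k) - T (2 * k + 1)))) =
    (\<lambda>k. complex_of_real (2 * sech_pole (2 * k) / ((sech_pole (2 * k))\<^sup>2 + x\<^sup>2) -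
        2 * sech_pole (2 * k + 1) / ((sech_pole (2 * k + 1))\<^sup>2 + x\<^sup>2)))"
    by (simp add: T_def diff_divide_distrib right_diff_distrib pi_cancel)
  also have "complex_of_real (inverse (2 * pi)) * of_real (2 * pi / cosh x) = complex_of_real (sech x)"
    by (simp add: sech_def)
  finally show ?thesis
    by (simp only: sums_of_real_iff)
qed

lemma has_bochner_integral_inverse_square_plus:
  assumes a: "a > 0"
  shows "has_bochner_integral halfline (\<lambda>x. 1 / (a\<^sup>2 + x\<^sup>2)) (pi / (2 * a))"
proof -
  have ein: "einterval 0 \<infinity> = {0<..}"
    by (auto simp: einterval_def)
  let ?F = "\<lambda>x. arctan (x / a) / a"
  have nz: "a\<^sup>2 + x\<^sup>2 \<noteq> 0" for x
    using a by (simp add: add_nonneg_eq_0_iff)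
  have F: "DERIV ?F x :> 1 / (a\<^sup>2 + x\<^sup>2)" for x
  proof -
    have "1 / a * inverse (1 + (x / a)\<^sup>2) / a = 1 / (a\<^sup>2 * (1 + (x / a)\<^sup>2))"
      by (simp add: power2_eq_square divide_inverse)
    also have "a\<^sup>2 * (1 + (x / a)\<^sup>2) = a\<^sup>2 + x\<^sup>2"
      using a by (simp add: distrib_left power_divide)
    finally show ?thesis
      using a by (auto intro!: derivative_eq_intros)
  qed
  have A: "((?F \<circ> real_of_ereal) \<longlongrightarrow> 0) (at_right 0)"
  proof -
    have "isCont ?F 0" using F by (rule DERIV_isCont)
    then have "(?F \<longlongrightarrow> 0) (at_right 0)"
      by (simp add: isCont_def filterlim_at_split)
    then show ?thesis by (simp add: ereal_tendsto_simps zero_ereal_def)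
  qed
  have B: "((?F \<circ> real_of_ereal) \<longlongrightarrow> pi / 2 / a) (at_left \<infinity>)"
  proof -
    have "filterlim (\<lambda>x. x / a) at_top at_top"
      using a by real_asymp
    then have "(?F \<longlongrightarrow> pi / 2 / a) at_top"
      using a by (intro tendsto_divide filterlim_compose[OF tendsto_arctan_at_top]) auto
    then show ?thesis by (simp add: ereal_tendsto_simps)
  qed
  have "set_integrable lborel (einterval 0 \<infinity>) (\<lambda>x. 1 / (a\<^sup>2 + x\<^sup>2))"
    "(LBINT x=0..\<infinity>. 1 / (a\<^sup>2 + x\<^sup>2)) = pi / 2 / a - 0"
    by (rule interval_integral_FTC_nonneg[OF _ F _ _ A B]; use nz in \<open>auto intro!: continuous_intros\<close>)+
  then show ?thesis
    by (simp add: has_bochner_integral_iff integrable_restrict_space integral_restrict_space ein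
        set_integrable_def interval_lebesgue_integral_def set_lebesgue_integral_def mult.commute)
qed

text \<open>Subtracting the expansion at x from the one at 0 turns each term 2b/(b^2 + x^2) into x^2
  times 2 / (b (b^2 + x^2)). The factor x^2 cancels, each quotient integrates to pi / b^2, and with
  b = pi (n + 1/2) the alternating sum is 4/pi times Catalan's series, grouped in pairs.\<close>

lemma has_bochner_integral_one_minus_sech:
  "has_bochner_integral halfline (\<lambda>x. (1 - sech x) / x\<^sup>2) (4 * catalan_const / pi)"
proof -
  define h where "h = (\<lambda>n x. 2 / sech_pole n * (1 / ((sech_pole n)\<^sup>2 + x\<^sup>2)))"
  define f where "f = (\<lambda>k x. h (2 * k) x - h (2 * k + 1) x)"
  have h: "has_bochner_integral halfline (h n) (pi / (sech_pole n)\<^sup>2)" for n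
  proof -
    have "has_bochner_integral halfline (h n) (2 / sech_pole n * (pi / (2 * sech_pole n)))"
      unfolding h_def by (intro has_bochner_integral_mult_right has_bochner_integral_inverse_square_plus sech_pole_pos)
    then show ?thesis by (simp add: power2_eq_square)
  qed
  have h_nonneg: "h n x \<ge> 0" for n x
    using sech_pole_pos[of n] by (simp add: h_def)
  have f: "has_bochner_integral halfline (f k) (pi / (sech_pole (2 * k))\<^sup>2 - pi / (sech_pole (2 * k + 1))\<^sup>2)" for k
    unfolding f_def by (intro has_bochner_integral_diff h)
  have f_sums: "(\<lambda>k. f k x) sums ((1 - sech x) / x\<^sup>2)" if "x > 0" for x
  proof -
    have "(\<lambda>k. ((2 * sech_pole (2 * k) / ((sech_pole (2 * k))\<^sup>2 + 0\<^sup>2) -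
            2 * sech_pole (2 * k + 1) / ((sech_pole (2 * k + 1))\<^sup>2 + 0\<^sup>2)) -
          (2 * sech_pole (2 * k) / ((sech_pole (2 * k))\<^sup>2 + x\<^sup>2) -
            2 * sech_pole (2 * k + 1) / ((sech_pole (2 * k + 1))\<^sup>2 + x\<^sup>2))) / x\<^sup>2) sums ((sech 0 - sech x) / x\<^sup>2)"
      by (intro sums_divide sums_diff sech_partial_fractions)
    moreover have hx: "(2 * sech_pole n / ((sech_pole n)\<^sup>2 + 0\<^sup>2) - 2 * sech_pole n / ((sech_pole n)\<^sup>2 + x\<^sup>2)) / x\<^sup>2 = h n x" for n
    proof -
      define b where "b = sech_pole n"
      have "b > 0" unfolding b_def by (rule sech_pole_pos)
      then have "b\<^sup>2 + x\<^sup>2 > 0" by (simp add: add_pos_nonneg)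
      have "(2 * b / (b\<^sup>2 + 0\<^sup>2) - 2 * b / (b\<^sup>2 + x\<^sup>2)) / x\<^sup>2 = 2 / b * (1 / (b\<^sup>2 + x\<^sup>2))"
        using \<open>b > 0\<close> \<open>b\<^sup>2 + x\<^sup>2 > 0\<close> that by (simp add: divide_simps) (simp add: algebra_simps power2_eq_square)
      then show ?thesis by (simp add: h_def b_def)
    qed
    have "((2 * sech_pole (2 * k) / ((sech_pole (2 * k))\<^sup>2 + 0\<^sup>2) -
            2 * sech_pole (2 * k + 1) / ((sech_pole (2 * k + 1))\<^sup>2 + 0\<^sup>2)) -
          (2 * sech_pole (2 * k) / ((sech_pole (2 * k))\<^sup>2 + x\<^sup>2) -
            2 * sech_pole (2 * k + 1) / ((sech_pole (2 * k + 1))\<^sup>2 + x\<^sup>2))) / x\<^sup>2 = f k x" for k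
      unfolding f_def hx[symmetric] by (simp only: diff_divide_distrib)
    ultimately show ?thesis by (simp add: sech_def)
  qed
  have summ: "summable (\<lambda>k. pi / (sech_pole (2 * k))\<^sup>2 + pi / (sech_pole (2 * k + 1))\<^sup>2)"
  proof (rule summable_comparison_test')
    show "summable (\<lambda>k. 1 / real k ^ 2 + 1 / real k ^ 2)"
      using inverse_power_summable[of 2] by (intro summable_add) (auto simp: field_simps)
    fix k :: nat assume k: "k \<ge> 1"
    have "pi / (sech_pole n)\<^sup>2 \<le> 1 / real k ^ 2" if "k \<le> n" for n
    proof -
      have "pi * real k ^ 2 \<le> pi * pi * (real n + 1 / 2) ^ 2"
        using that pi_gt3 by (intro mult_mono power_mono) auto
      then show ?thesis
        using k by (simp add: sech_pole_def divide_simps power_mult_distrib power2_eq_square add_nonneg_pos add_nonneg_eq_0_iff mult_ac)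
    qed
    from this[of "2 * k"] this[of "2 * k + 1"]
    show "norm (pi / (sech_pole (2 * k))\<^sup>2 + pi / (sech_pole (2 * k + 1))\<^sup>2) \<le> 1 / real k ^ 2 + 1 / real k ^ 2"
      by simp
  qed
  have 1: "integrable halfline (f k)" for k
    using f[of k] by (simp add: has_bochner_integral_iff)
  have 2: "AE x in halfline. summable (\<lambda>k. norm (f k x))"
  proof (rule AE_I2, rule summable_comparison_test')
    fix x and k :: nat
    show "summable (\<lambda>k. 2 / pi * (pi / (sech_pole (2 * k))\<^sup>2 + pi / (sech_pole (2 * k + 1))\<^sup>2))"
      by (intro summable_mult summ)
    have hb: "h n x \<le> 2 / pi * (pi / (sech_pole n)\<^sup>2)" for n
    proof -
      define b where "b = sech_pole n"
      \<comment> \<open>All poles thus exceed 1, which makes the bound for \<open>h n x\<close>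
        uniform in x.\<close>
      have "pi * (1 / 2) \<le> b"
        unfolding b_def sech_pole_def by (intro mult_left_mono) auto
      then have b: "b \<ge> 1" using pi_gt3 by linarith
      have "b\<^sup>2 \<le> b * (b\<^sup>2 + x\<^sup>2)"
        using b mult_mono[of 1 b "b\<^sup>2" "b\<^sup>2 + x\<^sup>2"] by simp
      then have "2 / (b * (b\<^sup>2 + x\<^sup>2)) \<le> 2 / b\<^sup>2"
        using b by (intro divide_left_mono mult_pos_pos add_pos_nonneg) auto
      then show ?thesis by (simp add: h_def b_def)
    qed
    show "norm (norm (f k x)) \<le> 2 / pi * (pi / (sech_pole (2 * k))\<^sup>2 + pi / (sech_pole (2 * k + 1))\<^sup>2)" 
      using hb[of "2 * k"] hb[of "2 * k + 1"] h_nonneg[of "2 * k" x] h_nonneg[of "2 * k + 1" x]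
      by (simp only: f_def distrib_left) simp
  qed
  have 3: "summable (\<lambda>k. \<integral>x. norm (f k x) \<partial>halfline)"
  proof (rule summable_comparison_test'[OF summ])
    fix k :: nat
    have "(\<integral>x. norm (f k x) \<partial>halfline) \<le> (\<integral>x. h (2 * k) x + h (2 * k + 1) x \<partial>halfline)"
    proof (rule integral_mono)
      show "norm (f k x) \<le> h (2 * k) x + h (2 * k + 1) x" for x
        using h_nonneg[of "2 * k" x] h_nonneg[of "2 * k + 1" x] by (simp add: f_def)
    qed (use 1 h in \<open>auto simp: has_bochner_integral_iff\<close>)
    also have "\<dots> = pi / (sech_pole (2 * k))\<^sup>2 + pi / (sech_pole (2 * k + 1))\<^sup>2"
      using h[of "2 * k"] h[of "2 * k + 1"] by (simp add: has_bochner_integral_iff)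
    finally show "norm (\<integral>x. norm (f k x) \<partial>halfline) \<le> pi / (sech_pole (2 * k))\<^sup>2 + pi / (sech_pole (2 * k + 1))\<^sup>2"
      by simp
  qed
  have eq: "(\<Sum>k. f k x) = (1 - sech x) / x\<^sup>2" if "x \<in> space halfline" for x
    using f_sums[of x] that by (simp add: space_restrict_space sums_iff)
  have "integrable halfline (\<lambda>x. \<Sum>k. f k x)"
    by (rule integrable_suminf[OF 1 2 3])
  then have int: "integrable halfline (\<lambda>x. (1 - sech x) / x\<^sup>2)"
    by (subst (asm) Bochner_Integration.integrable_cong[OF refl eq])
  have "(\<lambda>k. integral\<^sup>L halfline (f k)) sums (\<integral>x. (\<Sum>k. f k x) \<partial>halfline)"
    by (rule sums_integral[OF 1 2 3])
  also have "(\<integral>x. (\<Sum>k. f k x) \<partial>halfline) = (\<integral>x. (1 - sech x) / x\<^sup>2 \<partial>halfline)"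
    by (rule Bochner_Integration.integral_cong[OF refl eq])
  also have "(\<lambda>k. integral\<^sup>L halfline (f k)) = (\<lambda>k. pi / (sech_pole (2 * k))\<^sup>2 - pi / (sech_pole (2 * k + 1))\<^sup>2)"
    using f by (simp add: has_bochner_integral_iff)
  finally have I: "(\<lambda>k. pi / (sech_pole (2 * k))\<^sup>2 - pi / (sech_pole (2 * k + 1))\<^sup>2) sums
                  (\<integral>x. (1 - sech x) / x\<^sup>2 \<partial>halfline)" .
  have "summable (\<lambda>k. (-1) ^ k / (2 * real k + 1)\<^sup>2)"
  proof (rule summable_comparison_test')
    show "summable (\<lambda>k. 1 / real k ^ 2)"
      using inverse_power_summable[of 2] by (auto simp: field_simps)
    fix k :: nat assume "k \<ge> 1"
    then show "norm ((-1) ^ k / (2 * real k + 1)\<^sup>2) \<le> 1 / real k ^ 2"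
      by (auto simp: norm_divide intro!: divide_left_mono power_mono mult_pos_pos)
  qed
  then have "(\<lambda>k. 4 / pi * ((-1) ^ k / (2 * real k + 1)\<^sup>2)) sums (4 / pi * catalan_const)"
    unfolding catalan_const_def by (intro sums_mult summable_sums)
  then have "(\<lambda>n. \<Sum>k=n*2..<n*2+2. 4 / pi * ((-1) ^ k / (2 * real k + 1)\<^sup>2)) sums (4 / pi * catalan_const)"
    by (rule sums_group) auto
  moreover have "(\<Sum>k=n*2..<n*2+2. 4 / pi * ((-1) ^ k / (2 * real k + 1)\<^sup>2)) =
                 pi / (sech_pole (2 * n))\<^sup>2 - pi / (sech_pole (2 * n + 1))\<^sup>2" for n
  proof -
    have p: "pi / (sech_pole k)\<^sup>2 = 4 / pi * (1 / (2 * real k + 1)\<^sup>2)" for k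
    proof -
      have e: "sech_pole k = pi / 2 * (2 * real k + 1)" by (simp add: sech_pole_def)
      show ?thesis unfolding e by (simp add: power_mult_distrib power_divide power2_eq_square)
    qed
    have "{n*2..<n*2+2} = {2*n, Suc (2*n)}" by auto
    then show ?thesis unfolding p by simp
  qed
  ultimately have "(\<integral>x. (1 - sech x) / x\<^sup>2 \<partial>halfline) = 4 / pi * catalan_const"
    using I by (simp add: sums_iff)
  then show ?thesis
    using int by (simp add: has_bochner_integral_iff)
qed

subsection \<open>Powers of the hyperbolic secant\<close>

definition csech_pow :: "nat \<Rightarrow> complex \<Rightarrow> complex" where
  "csech_pow j z = inverse (cosh z) ^ j"

text \<open>From cosh z = exp(z)/2 * (1 + exp(-2z)): for |Im z| < 1/2 the angle 2 Im z stays below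
  pi/2, so the last factor has real part at least 1.\<close>

lemma norm_cosh_half_strip:
  assumes "z \<in> half_strip (1 / 2)"
  shows "norm (cosh z) \<ge> exp (Re z) / 2"
proof -
  have "cos (2 * Im z) \<ge> 0"
    using assms pi_gt3 by (intro cos_ge_zero) (auto simp: half_strip_def)
  then have "Re (1 + exp (- (2 * z))) \<ge> 1"
    by (simp add: Re_exp)
  then have "1 \<le> norm (1 + exp (- (2 * z)))"
    using complex_Re_le_cmod order_trans by blast
  then have "exp (Re z) / 2 * 1 \<le> exp (Re z) / 2 * norm (1 + exp (- (2 * z)))"
    by (intro mult_left_mono) auto
  moreover have "cosh z = exp z / 2 * (1 + exp (- (2 * z)))"
    by (simp add: cosh_def scaleR_conv_of_real algebra_simps flip: exp_add)
  then have "norm (cosh z) = exp (Re z) / 2 * norm (1 + exp (- (2 * z)))"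
    by (simp only: norm_mult norm_divide norm_exp_eq_Re) simp
  ultimately show ?thesis by simp
qed

lemma strip_decay_csech_pow:
  assumes "j \<ge> 1"
  shows "strip_decay (csech_pow j)"
proof -
  have nz: "cosh z \<noteq> 0" if "z \<in> half_strip (1 / 2)" for z
  proof
    assume "cosh z = 0"
    with norm_cosh_half_strip[OF that] have "exp (Re z) \<le> 0" by simp
    then show False using exp_gt_zero[of "Re z"] by linarith
  qed
  have "(\<lambda>z. cos (\<i> * z)) holomorphic_on half_strip (1 / 2)"
    by (intro holomorphic_intros)
  then have "csech_pow j holomorphic_on half_strip (1 / 2)"
    unfolding csech_pow_def using nz by (intro holomorphic_intros) (auto simp: cosh_conv_cos)
  moreover have "norm (csech_pow j z) \<le> 2 ^ j * exp (- (real j * Re z))"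
    if z: "z \<in> half_strip (1 / 2)" for z
  proof -
    have "inverse (norm (cosh z)) \<le> inverse (exp (Re z) / 2)"
      using norm_cosh_half_strip[OF z] by (intro le_imp_inverse_le) auto
    also have "\<dots> = 2 * exp (- Re z)"
      by (simp add: exp_minus field_simps)
    finally have "inverse (norm (cosh z)) ^ j \<le> (2 * exp (- Re z)) ^ j"
      by (intro power_mono) auto
    then show ?thesis
      by (simp add: csech_pow_def norm_power norm_inverse power_mult_distrib flip: exp_of_nat_mult)
  qed
  ultimately show ?thesis
    unfolding strip_decay_def using assms
    by (intro exI[of _ "1 / 2"] conjI exI[of _ "2 ^ j"] exI[of _ "real j"]) auto
qed

lemma csech_pow_of_real: "csech_pow j (of_real x) = of_real (sech x ^ j)"
proof -
  have "cosh (complex_of_real x) = of_real (cosh x)"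
    by (simp add: cosh_def scaleR_conv_of_real flip: exp_of_real)
  then show ?thesis
    by (simp add: csech_pow_def sech_def inverse_eq_divide)
qed

section \<open>Derivatives and bounds for real powers of sech\<close>

lemma sech_pos: "sech x > 0" and sech_le_1: "sech x \<le> 1" and sech_0: "sech 0 = 1"
  using cosh_real_ge_1[of x] by (auto simp: sech_def)

lemma sech_le_exp: "x \<ge> 0 \<Longrightarrow> sech x \<le> 2 * exp (- x)"
  by (simp add: sech_def cosh_def exp_minus field_simps add_pos_pos)

definition sech_pow_deriv2 :: "nat \<Rightarrow> real \<Rightarrow> real" where
  "sech_pow_deriv2 j x = real j ^ 2 * sech x ^ j - real j * (real j + 1) * sech x ^ (j + 2)"

lemma sech_has_derivative: "(sech has_real_derivative (- (tanh x * sech x))) (at x)"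
  unfolding sech_def by (auto intro!: derivative_eq_intros simp: tanh_def field_simps)

lemma sech_pow_has_derivative:
  "((\<lambda>x. sech x ^ j) has_real_derivative (- (real j * tanh x * sech x ^ j))) (at x)"
  using DERIV_power[OF sech_has_derivative[of x], of j] by (cases j) (simp_all add: algebra_simps)

lemma sech_pow_has_derivative2:
  "((\<lambda>x. - (real j * tanh x * sech x ^ j)) has_real_derivative sech_pow_deriv2 j x) (at x)"
proof -
  have sq: "(tanh x)\<^sup>2 = 1 - (sech x)\<^sup>2"
    by (simp add: tanh_def sech_def sinh_square_eq power_divide divide_simps)
  have t: "(tanh has_real_derivative (sech x)\<^sup>2) (at x)"
    by (auto intro!: derivative_eq_intros simp: sq)
  have "((\<lambda>x. - (real j * tanh x * sech x ^ j)) has_real_derivative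
     - (real j * (sech x)\<^sup>2 * sech x ^ j + - (real j * tanh x * sech x ^ j) * (real j * tanh x))) (at x)"
    by (intro DERIV_minus DERIV_mult DERIV_cmult t sech_pow_has_derivative)
  also have "- (real j * (sech x)\<^sup>2 * sech x ^ j + - (real j * tanh x * sech x ^ j) * (real j * tanh x)) =
     - (real j * (sech x)\<^sup>2 * sech x ^ j) + real j ^ 2 * (tanh x)\<^sup>2 * sech x ^ j"
    by (simp add: power2_eq_square algebra_simps)
  also have "\<dots> = sech_pow_deriv2 j x"
    unfolding sq by (simp add: sech_pow_deriv2_def power_add power2_eq_square algebra_simps)
  finally show ?thesis .
qed

lemma continuous_on_sech [continuous_intros]:
  "continuous_on A f \<Longrightarrow> continuous_on A (\<lambda>x. sech (f x))"
  unfolding sech_def by (intro continuous_intros) auto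

lemma continuous_on_sech_pow_deriv2: "continuous_on A (sech_pow_deriv2 j)"
  unfolding sech_pow_deriv2_def by (intro continuous_intros)

text \<open>The weight 1 + |ln x| lets one limit control both boundary terms at infinity, f' and ln
  x * f' for f = sech^j.\<close>

lemma sech_pow_tendsto_0:
  assumes "j \<ge> 1"
  shows "((\<lambda>x. sech x ^ j * (1 + \<bar>ln x\<bar>)) \<longlongrightarrow> 0) at_top"
proof (rule Lim_null_comparison)
  show "((\<lambda>x. 2 * exp (- x) * (1 + ln x) :: real) \<longlongrightarrow> 0) at_top"
    by real_asymp
  show "\<forall>\<^sub>F x in at_top. norm (sech x ^ j * (1 + \<bar>ln x\<bar>)) \<le> 2 * exp (- x) * (1 + ln x)"
    using eventually_ge_at_top[of 1]
  proof eventually_elim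
    case (elim x)
    have "sech x ^ j \<le> sech x ^ 1"
      using assms sech_pos[of x] sech_le_1[of x] by (intro power_decreasing) auto
    also have "\<dots> \<le> 2 * exp (- x)"
      using sech_le_exp[of x] elim by simp
    finally show ?case
      using elim sech_pos[of x] by (simp add: abs_mult mult_right_mono)
  qed
qed

text \<open>Bernoulli's inequality, which reduces integrability of (1 - sech^j) / x^2 to the case j
  = 1.\<close>

lemma one_minus_sech_pow_bound: "0 \<le> 1 - sech x ^ j" "1 - sech x ^ j \<le> real j * (1 - sech x)"
proof -
  show "0 \<le> 1 - sech x ^ j"
    using sech_pos[of x] sech_le_1[of x] by (simp add: power_le_one)
  have "1 + real j * (sech x - 1) \<le> (1 + (sech x - 1)) ^ j"
    using sech_pos[of x] by (intro Bernoulli_inequality) auto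
  then show "1 - sech x ^ j \<le> real j * (1 - sech x)"
    by (simp add: algebra_simps)
qed

lemma integrable_one_minus_sech_pow: "integrable halfline (\<lambda>x. (1 - sech x ^ j) / x\<^sup>2)"
proof (rule Bochner_Integration.integrable_bound)
  show "integrable halfline (\<lambda>x. real j * ((1 - sech x) / x\<^sup>2))"
    using has_bochner_integral_one_minus_sech
    by (intro integrable_mult_right) (simp add: has_bochner_integral_iff)
  show "(\<lambda>x. (1 - sech x ^ j) / x\<^sup>2) \<in> borel_measurable halfline"
    by (intro borel_measurable_halfline continuous_intros) auto
  show "AE x in halfline. norm ((1 - sech x ^ j) / x\<^sup>2) \<le> norm (real j * ((1 - sech x) / x\<^sup>2))"
  proof (rule AE_I2)
    fix x
    have "norm ((1 - sech x ^ j) / x\<^sup>2) = (1 - sech x ^ j) / x\<^sup>2"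
      using one_minus_sech_pow_bound(1)[of x j] by simp
    also have "\<dots> \<le> (real j * (1 - sech x)) / x\<^sup>2"
      by (intro divide_right_mono one_minus_sech_pow_bound) auto
    finally show "norm ((1 - sech x ^ j) / x\<^sup>2) \<le> norm (real j * ((1 - sech x) / x\<^sup>2))"
      using sech_le_1[of x] by (simp add: abs_mult)
  qed
qed

text \<open>The normalised Mellin transform of the second derivative of \<open>sech\<^sup>j\<close>.\<close>

definition sech_mellin_comb :: "nat \<Rightarrow> complex \<Rightarrow> complex" where
  "sech_mellin_comb j s = of_nat j ^ 2 * mellin_ext (csech_pow j) s
     - of_nat j * (of_nat j + 1) * mellin_ext (csech_pow (j + 2)) s"

lemma sech_mellin_comb_at_1:
  assumes j: "j \<ge> 1"
  shows "sech_mellin_comb j 1 = 0"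
    and "(sech_mellin_comb j has_field_derivative
            of_real (\<integral>x. (1 - sech x ^ j) / x\<^sup>2 \<partial>halfline)) (at 1)"
proof -
  define g where "g = (\<lambda>j x. csech_pow j (complex_of_real x))"
  have sd: "strip_decay (csech_pow j)" "strip_decay (csech_pow (j + 2))"
    using j by (auto intro: strip_decay_csech_pow)
  have d: "exp_decay (g j)" "exp_decay (g (j + 2))"
    unfolding g_def using sd by (auto intro: strip_decay_imp_exp_decay)
  define M where "M = (\<lambda>s. of_nat j ^ 2 * mellin (g j) s - of_nat j * (of_nat j + 1) * mellin (g (j + 2)) s)"
  have comb: "sech_mellin_comb j s = rGamma s * M s" if "Re s > 0" for s
    using that sd by (simp add: sech_mellin_comb_def M_def mellin_ext_eq_mellin g_def algebra_simps)
  have g_comb: "of_nat j ^ 2 * g j x - of_nat j * (of_nat j + 1) * g (j + 2) x = of_real (sech_pow_deriv2 j x)" for x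
    unfolding g_def csech_pow_of_real sech_pow_deriv2_def by simp
  have int0: "integrable halfline (g j)" "integrable halfline (g (j + 2))"
  proof -
    have "integrable halfline (\<lambda>x. of_real x powr (1 - 1) * g k x)" if "exp_decay (g k)" for k
      using mellin_integrable[OF that, of 1] by simp
    moreover have "integrable halfline (\<lambda>x. of_real x powr (1 - 1) * g k x) \<longleftrightarrow> integrable halfline (g k)" for k
      by (intro Bochner_Integration.integrable_cong) (auto simp: space_restrict_space)
    ultimately show "integrable halfline (g j)" "integrable halfline (g (j + 2))"
      using d by blast+
  qed
  have M1: "M 1 = of_real (\<integral>x. sech_pow_deriv2 j x \<partial>halfline)"
  proof -
    have "mellin (g k) 1 = integral\<^sup>L halfline (g k)" for k
      unfolding mellin_def by (intro Bochner_Integration.integral_cong) (auto simp: space_restrict_space)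
    then have "M 1 = (\<integral>x. of_nat j ^ 2 * g j x - of_nat j * (of_nat j + 1) * g (j + 2) x \<partial>halfline)"
      using int0 unfolding M_def by (subst Bochner_Integration.integral_diff) auto
    then show ?thesis by (simp only: g_comb integral_complex_of_real)
  qed
  have int_d2: "integrable halfline (sech_pow_deriv2 j)"
  proof -
    have "integrable halfline (\<lambda>x. of_nat j ^ 2 * g j x - of_nat j * (of_nat j + 1) * g (j + 2) x)"
      using int0 by (intro Bochner_Integration.integrable_diff integrable_mult_right) auto
    then show ?thesis by (simp only: g_comb complex_of_real_integrable_eq)
  qed
  have tanh_le: "\<bar>tanh x\<bar> \<le> 1" for x :: real
    using tanh_real_lt_1[of x] tanh_real_gt_neg1[of x] by (simp add: abs_if)
  have abs_S': "norm (- (real j * tanh x * sech x ^ j)) \<le> real j * sech x ^ j" for x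
  proof -
    have "norm (- (real j * tanh x * sech x ^ j)) = (real j * sech x ^ j) * \<bar>tanh x\<bar>"
      using sech_pos[of x] by (simp add: abs_mult)
    also have "\<dots> \<le> (real j * sech x ^ j) * 1"
      using sech_pos[of x] by (intro mult_left_mono tanh_le) auto
    finally show ?thesis by simp
  qed
  \<comment> \<open>The antiderivative f' contains the factor tanh x, zero at 0, and f' decays at
    infinity.\<close>
  have "(\<integral>x. sech_pow_deriv2 j x \<partial>halfline) = 0 - 0"
  proof (rule halfline_FTC)
    show "((\<lambda>x. - (real j * tanh x * sech x ^ j)) has_vector_derivative sech_pow_deriv2 j x) (at x)" for x
      using sech_pow_has_derivative2 by (simp add: has_real_derivative_iff_has_vector_derivative)
    have "((\<lambda>x. - (real j * tanh x * sech x ^ j)) \<longlongrightarrow> - (real j * tanh 0 * sech 0 ^ j)) (at 0)"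
      using DERIV_isCont[OF sech_pow_has_derivative2] by (rule isContD)
    then show "((\<lambda>x. - (real j * tanh x * sech x ^ j)) \<longlongrightarrow> 0) (at_right 0)"
      by (simp add: filterlim_at_split)
    show "((\<lambda>x. - (real j * tanh x * sech x ^ j)) \<longlongrightarrow> 0) at_top"
    proof (rule Lim_null_comparison)
      show "((\<lambda>x. real j * (sech x ^ j * (1 + \<bar>ln x\<bar>))) \<longlongrightarrow> 0) at_top"
        by (intro tendsto_mult_right_zero sech_pow_tendsto_0 j)
      show "\<forall>\<^sub>F x in at_top. norm (- (real j * tanh x * sech x ^ j)) \<le> real j * (sech x ^ j * (1 + \<bar>ln x\<bar>))"
      proof (intro always_eventually allI)
        fix x
        have "real j * sech x ^ j * 1 \<le> real j * sech x ^ j * (1 + \<bar>ln x\<bar>)"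
          using sech_pos[of x] by (intro mult_left_mono) auto
        then show "norm (- (real j * tanh x * sech x ^ j)) \<le> real j * (sech x ^ j * (1 + \<bar>ln x\<bar>))"
          using abs_S'[of x] by (simp add: mult.assoc)
      qed
    qed
  qed (use int_d2 continuous_on_sech_pow_deriv2 in auto)
  then have M1_0: "M 1 = 0" using M1 by simp
  then show "sech_mellin_comb j 1 = 0" using comb[of 1] by simp

  define L where "L = (\<lambda>k. \<integral>x. of_real (ln x) * (of_real x powr (1 - 1) * g k x) \<partial>halfline)"
  have intL: "integrable halfline (\<lambda>x. of_real (ln x) * (of_real x powr (1 - 1) * g k x))"
    if "exp_decay (g k)" for k
    using mellin_has_field_derivative(2)[OF that, of 1] by simp
  have dM: "(M has_field_derivative of_nat j ^ 2 * L j - of_nat j * (of_nat j + 1) * L (j + 2)) (at 1)"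
    unfolding M_def L_def using d
    by (intro derivative_intros DERIV_cmult mellin_has_field_derivative(1)) auto
  have L_comb: "of_nat j ^ 2 * (of_real (ln x) * (of_real x powr (1 - 1) * g j x)) -
        of_nat j * (of_nat j + 1) * (of_real (ln x) * (of_real x powr (1 - 1) * g (j + 2) x)) =
        of_real (ln x * sech_pow_deriv2 j x)" if "x \<in> space halfline" for x
  proof -
    have "of_real x powr (1 - 1) = (1 :: complex)" using that by (auto simp: space_restrict_space)
    then show ?thesis unfolding of_real_mult g_comb[symmetric] by (simp add: algebra_simps)
  qed
  have int_comb: "integrable halfline (\<lambda>x. of_nat j ^ 2 * (of_real (ln x) * (of_real x powr (1 - 1) * g j x)) -
        of_nat j * (of_nat j + 1) * (of_real (ln x) * (of_real x powr (1 - 1) * g (j + 2) x)))"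
    using d by (intro Bochner_Integration.integrable_diff integrable_mult_right intL)
  have int_ln: "integrable halfline (\<lambda>x. ln x * sech_pow_deriv2 j x)"
  proof -
    have "integrable halfline (\<lambda>x. complex_of_real (ln x * sech_pow_deriv2 j x))"
      using int_comb by (subst (asm) Bochner_Integration.integrable_cong[OF refl L_comb]) auto
    then show ?thesis by (simp only: complex_of_real_integrable_eq)
  qed
  have "of_nat j ^ 2 * L j - of_nat j * (of_nat j + 1) * L (j + 2) =
     (\<integral>x. of_nat j ^ 2 * (of_real (ln x) * (of_real x powr (1 - 1) * g j x)) -
        of_nat j * (of_nat j + 1) * (of_real (ln x) * (of_real x powr (1 - 1) * g (j + 2) x)) \<partial>halfline)"
    unfolding L_def using intL d
    by (subst Bochner_Integration.integral_diff) (auto simp del: diff_self)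
  also have "\<dots> = (\<integral>x. complex_of_real (ln x * sech_pow_deriv2 j x) \<partial>halfline)"
    by (rule Bochner_Integration.integral_cong[OF refl L_comb])
  also have "\<dots> = of_real (\<integral>x. ln x * sech_pow_deriv2 j x \<partial>halfline)"
    by (rule integral_complex_of_real)
  also have "(\<integral>x. ln x * sech_pow_deriv2 j x \<partial>halfline) = (\<integral>x. (1 - sech x ^ j) / x\<^sup>2 \<partial>halfline)"
  proof -
    \<comment> \<open>Both integrations by parts at once: with f = sech^j this is ln x * f' + (1 -
      f)/x, and the terms f'/x cancel in its derivative.\<close>
    let ?F = "\<lambda>x. ln x * (- (real j * tanh x * sech x ^ j)) + (1 - sech x ^ j) / x"
    have "(\<integral>x. ln x * sech_pow_deriv2 j x - (1 - sech x ^ j) / x\<^sup>2 \<partial>halfline) = 0 - 0"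
    proof (rule halfline_FTC)
      show "(?F has_vector_derivative ln x * sech_pow_deriv2 j x - (1 - sech x ^ j) / x\<^sup>2) (at x)"
        if "x > 0" for x
      proof -
        have "(?F has_real_derivative
            (1 / x * (- (real j * tanh x * sech x ^ j)) + sech_pow_deriv2 j x * ln x) +
            ((0 - - (real j * tanh x * sech x ^ j)) * x - (1 - sech x ^ j) * 1) / (x * x)) (at x)"
          using that
          by (intro DERIV_add DERIV_mult DERIV_divide DERIV_diff DERIV_const DERIV_ident DERIV_ln_divide
              sech_pow_has_derivative2 sech_pow_has_derivative) auto
        also have "(1 / x * (- (real j * tanh x * sech x ^ j)) + sech_pow_deriv2 j x * ln x) +
            ((0 - - (real j * tanh x * sech x ^ j)) * x - (1 - sech x ^ j) * 1) / (x * x) =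
            ln x * sech_pow_deriv2 j x - (1 - sech x ^ j) / x\<^sup>2"
          using that by (simp add: diff_divide_distrib power2_eq_square)
        finally show ?thesis
          by (simp add: has_real_derivative_iff_has_vector_derivative)
      qed
      show "continuous_on {0<..} (\<lambda>x. ln x * sech_pow_deriv2 j x - (1 - sech x ^ j) / x\<^sup>2)"
        by (intro continuous_intros continuous_on_sech_pow_deriv2) auto
      show "integrable halfline (\<lambda>x. ln x * sech_pow_deriv2 j x - (1 - sech x ^ j) / x\<^sup>2)"
        by (intro Bochner_Integration.integrable_diff int_ln integrable_one_minus_sech_pow)
      show "(?F \<longlongrightarrow> 0) (at_right 0)"
      proof -
        \<comment> \<open>At 0 the zero of tanh beats the logarithm, and (1 - f)/x tends to -f'(0) =
          0.\<close>
        have "((\<lambda>x::real. ln x * tanh x) \<longlongrightarrow> 0) (at_right 0)"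
          unfolding tanh_altdef by real_asymp
        moreover have "((\<lambda>x. sech x ^ j) \<longlongrightarrow> sech 0 ^ j) (at_right 0)"
          using DERIV_isCont[OF sech_pow_has_derivative[of j 0]] by (simp add: isCont_def filterlim_at_split)
        ultimately have "((\<lambda>x. - real j * ((ln x * tanh x) * sech x ^ j)) \<longlongrightarrow> - real j * (0 * sech 0 ^ j)) (at_right 0)"
          by (intro tendsto_mult tendsto_const)
        moreover have "((\<lambda>x. - ((sech x ^ j - sech 0 ^ j) / (x - 0))) \<longlongrightarrow> - 0) (at_right 0)"
          using sech_pow_has_derivative[of j 0]
          by (intro tendsto_minus) (simp add: has_field_derivative_iff filterlim_at_split)
        ultimately have "((\<lambda>x. - real j * ((ln x * tanh x) * sech x ^ j) + - ((sech x ^ j - sech 0 ^ j) / (x - 0)))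
           \<longlongrightarrow> - real j * (0 * sech 0 ^ j) + - 0) (at_right 0)"
          by (rule tendsto_add)
        then show ?thesis
          by (simp add: sech_0 algebra_simps diff_divide_distrib)
      qed
      show "(?F \<longlongrightarrow> 0) at_top"
      proof (rule Lim_null_comparison)
        have "((\<lambda>x::real. 1 / x) \<longlongrightarrow> 0) at_top" by real_asymp
        then show "((\<lambda>x. real j * (sech x ^ j * (1 + \<bar>ln x\<bar>)) + 1 / x) \<longlongrightarrow> 0) at_top"
          by (intro tendsto_add_zero tendsto_mult_right_zero sech_pow_tendsto_0 j)
        show "\<forall>\<^sub>F x in at_top. norm (?F x) \<le> real j * (sech x ^ j * (1 + \<bar>ln x\<bar>)) + 1 / x"
          using eventually_gt_at_top[of 0]
        proof eventually_elim
          case (elim x)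
          have "norm (ln x * (- (real j * tanh x * sech x ^ j))) = \<bar>ln x\<bar> * norm (- (real j * tanh x * sech x ^ j))"
            by (simp add: abs_mult)
          also have "\<dots> \<le> (1 + \<bar>ln x\<bar>) * (real j * sech x ^ j)"
            by (intro mult_mono abs_S') auto
          finally have 1: "norm (ln x * (- (real j * tanh x * sech x ^ j))) \<le> real j * (sech x ^ j * (1 + \<bar>ln x\<bar>))"
            by (simp add: mult_ac)
          have "norm ((1 - sech x ^ j) / x) \<le> 1 / x"
            using one_minus_sech_pow_bound(1)[of x j] sech_pos[of x] elim by (simp add: divide_right_mono)
          with 1 show ?case
            using norm_triangle_ineq[of "ln x * (- (real j * tanh x * sech x ^ j))" "(1 - sech x ^ j) / x"] by linarith
        qed
      qed
    qed
    then show ?thesis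
      using int_ln integrable_one_minus_sech_pow[of j] by simp
  qed
  finally have dM': "(M has_field_derivative of_real (\<integral>x. (1 - sech x ^ j) / x\<^sup>2 \<partial>halfline)) (at 1)"
    using dM by simp
  \<comment> \<open>Because M vanishes at 1 the derivative of \<open>rGamma\<close> does not
    contribute, and \<open>rGamma\<close> takes the value 1 there.\<close>
  have "((\<lambda>s. rGamma s * M s) has_field_derivative
          of_real (\<integral>x. (1 - sech x ^ j) / x\<^sup>2 \<partial>halfline)) (at 1)"
    using has_field_derivative_rGamma_no_nonpos_int[of "1 :: complex" UNIV]
    by (auto intro!: derivative_eq_intros dM' simp: M1_0 Re_pos_not_nonpos_Int)
  then show "(sech_mellin_comb j has_field_derivative
            of_real (\<integral>x. (1 - sech x ^ j) / x\<^sup>2 \<partial>halfline)) (at 1)"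
    by (rule has_field_derivative_transform_within_open[where S = "{s. Re s > 0}"])
       (auto simp: open_halfspace_Re_gt comb)
qed

section \<open>Stirling polynomials and the Dirichlet series of powers of sech\<close>

lemma binomial_times_fact_eq_prod:
  "of_nat ((n + m) choose m) * fact m = (\<Prod>i=1..m. of_nat n + of_nat i :: 'a :: {semiring_char_0, comm_semiring_1})"
proof (induction m)
  case (Suc m)
  have "of_nat ((n + Suc m) choose Suc m) * fact (Suc m) =
        (of_nat (Suc m * (Suc (n + m) choose Suc m)) * fact m :: 'a)"
    by (simp only: fact_Suc of_nat_mult add_Suc_right mult_ac)
  also have "\<dots> = of_nat (Suc (n + m)) * (of_nat ((n + m) choose m) * fact m)"
    unfolding Suc_times_binomial of_nat_mult by (simp only: mult_ac)
  finally show ?case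
    unfolding Suc.IH by (simp add: mult_ac add_ac)
qed auto

text \<open>The defining identity of the polynomials at y = n + x. The shift x is free; x = (m+1)/2
  will make n + x half of the exponent 2n + m + 1.\<close>

lemma binomial_times_fact_eq_stirling:
  fixes x :: "'a :: {comm_ring_1, semiring_char_0}"
  shows "of_nat ((n + m) choose m) * fact m =
           (\<Sum>k\<le>m. (-1) ^ k * gen_stirling k m x * (of_nat n + x) ^ (m - k))"
proof -
  have "of_nat ((n + m) choose m) * fact m = (\<Prod>i=1..m. poly [:of_nat i - x, 1:] (of_nat n + x))"
    unfolding binomial_times_fact_eq_prod by (intro prod.cong) auto
  also have "\<dots> = poly (\<Prod>i=1..m. [:of_nat i - x, 1:]) (of_nat n + x)"
    by (rule poly_prod[symmetric])
  also have "\<dots> = (\<Sum>k\<le>m. (-1) ^ k * gen_stirling k m x * (of_nat n + x) ^ (m - k))"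
    unfolding gen_stirling_identity by (simp add: poly_sum poly_monom)
  finally show ?thesis .
qed

lemma binomial_le_power: "real ((n + m) choose m) \<le> (real n + real m) ^ m"
proof -
  have "real ((n + m) choose m) * 1 \<le> real ((n + m) choose m) * fact m"
    by (intro mult_left_mono) auto
  also have "\<dots> = (\<Prod>i=1..m. real n + real i)"
    by (rule binomial_times_fact_eq_prod)
  also have "\<dots> \<le> (\<Prod>i=1..m. real n + real m)"
    by (intro prod_mono) auto
  finally show ?thesis by simp
qed

text \<open>The negative binomial series in t = exp(-2x), applied to sech x = 2 exp(-x) / (1 +
  t).\<close>

lemma sech_pow_series:
  assumes x: "x > 0"
  shows "(\<lambda>n. 2 ^ Suc m * (-1) ^ n * real ((n + m) choose m) * exp (- ((2 * real n + real (Suc m)) * x)))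
           sums (sech x ^ Suc m)"
proof -
  define t where "t = exp (- (2 * x))"
  have t: "0 < t" "t < 1" using x by (auto simp: t_def)
  have "(\<lambda>n. (- real (Suc m) gchoose n) * t ^ n) sums (1 + t) powr (- real (Suc m))"
    using t by (intro gen_binomial_real) auto
  moreover have "(- real (Suc m) gchoose n) = (-1) ^ n * real ((n + m) choose m)" for n
  proof -
    have "(- real (Suc m) gchoose n) = (-1) ^ n * ((real (n + m)) gchoose n)"
      using gbinomial_minus[of "real (Suc m)" n] by (simp add: add_ac)
    also have "real (n + m) gchoose n = real ((n + m) choose n)"
      by (rule binomial_gbinomial[symmetric])
    also have "(n + m) choose n = (n + m) choose m"
      using binomial_symmetric[of n "n + m"] by simp
    finally show ?thesis .
  qed
  ultimately have "(\<lambda>n. (-1) ^ n * real ((n + m) choose m) * t ^ n) sums (1 + t) powr (- real (Suc m))"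
    by simp
  then have "(\<lambda>n. (2 * exp (- x)) ^ Suc m * ((-1) ^ n * real ((n + m) choose m) * t ^ n)) sums
               ((2 * exp (- x)) ^ Suc m * (1 + t) powr (- real (Suc m)))"
    by (rule sums_mult)
  also have "(2 * exp (- x)) ^ Suc m * (1 + t) powr (- real (Suc m)) = (2 * exp (- x) / (1 + t)) ^ Suc m"
    using t by (simp add: powr_minus powr_realpow power_divide power_mult_distrib power_inverse divide_inverse del: of_nat_Suc power_Suc)
  also have "2 * exp (- x) / (1 + t) = sech x"
  proof -
    have "1 + t = exp (- x) * (2 * cosh x)"
      by (simp add: cosh_def t_def distrib_left flip: exp_add)
    then show ?thesis by (simp add: sech_def)
  qed
  also have "(\<lambda>n. (2 * exp (- x)) ^ Suc m * ((-1) ^ n * real ((n + m) choose m) * t ^ n)) =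
     (\<lambda>n. 2 ^ Suc m * (-1) ^ n * real ((n + m) choose m) * exp (- ((2 * real n + real (Suc m)) * x)))"
  proof
    fix n
    have "exp (- x) ^ Suc m * t ^ n = exp (real (Suc m) * (- x) + real n * (- (2 * x)))"
      unfolding t_def exp_add exp_of_nat_mult ..
    also have "real (Suc m) * (- x) + real n * (- (2 * x)) = - ((2 * real n + real (Suc m)) * x)"
      by (simp add: algebra_simps)
    finally have E: "exp (- x) ^ Suc m * t ^ n = exp (- ((2 * real n + real (Suc m)) * x))" .
    show "(2 * exp (- x)) ^ Suc m * ((-1) ^ n * real ((n + m) choose m) * t ^ n) =
       2 ^ Suc m * (-1) ^ n * real ((n + m) choose m) * exp (- ((2 * real n + real (Suc m)) * x))"
      unfolding E[symmetric] power_mult_distrib by (simp only: mult_ac)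
  qed
  finally show ?thesis .
qed

text \<open>Shaped so that its derivative at s = 1 is a bracket sum of \<open>sech_F j\<close>: the
  first one for m = j - 1, the second one for m = j + 1.\<close>

definition stirling_eta :: "nat \<Rightarrow> complex \<Rightarrow> complex" where
  "stirling_eta m s = (\<Sum>k\<le>m. (-1/2) ^ k * gen_stirling k m (of_nat (Suc m) / 2) *
     mellin_ext (eta_kernel (real (Suc m) / 4)) (s - of_nat m + of_nat k))"

text \<open>Both sides are entire, so it is enough to compare series for Re s > m + 1, where the
  Dirichlet series of sech^(m+1) and all shifted alternating series converge absolutely.\<close>

lemma mellin_ext_csech_pow:
  "mellin_ext (csech_pow (Suc m)) s = 2 ^ (2 * m + 1) / fact m * 4 powr (- s) * stirling_eta m s"
proof (rule analytic_continuation_open[where s = "{s. Re s > real m + 1}" and s' = UNIV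
      and f = "mellin_ext (csech_pow (Suc m))"
      and g = "\<lambda>s. 2 ^ (2 * m + 1) / fact m * 4 powr (- s) * stirling_eta m s"])
  have "of_nat (m + 2) \<in> {s. Re s > real m + 1}" by simp
  then show "{s. Re s > real m + 1} \<noteq> {}" by blast
  show "mellin_ext (csech_pow (Suc m)) holomorphic_on UNIV"
    by (intro mellin_ext_holomorphic strip_decay_csech_pow) auto
  show "(\<lambda>s. 2 ^ (2 * m + 1) / fact m * 4 powr (- s) * stirling_eta m s) holomorphic_on UNIV"
    unfolding stirling_eta_def
    by (intro holomorphic_intros strip_decay_eta_kernel) auto
  fix s assume "s \<in> {s. Re s > real m + 1}"
  then have s: "Re s > real m + 1" by simp
  define a where "a = real (Suc m) / 4"
  have a: "a > 0" by (simp add: a_def)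
  define l where "l = (\<lambda>n. 2 * real n + real (Suc m))"
  have l: "l n > 0" for n by (simp add: l_def)
  define c where "c = (\<lambda>n. 2 ^ Suc m * (-1) ^ n * of_nat ((n + m) choose m) :: complex)"
  have "(\<lambda>n. c n * of_real (l n) powr (- s)) sums (rGamma s * mellin (\<lambda>x. csech_pow (Suc m) (of_real x)) s)"
  proof (rule mellin_exp_series)
    show "summable (\<lambda>n. norm (c n) * l n powr (- Re s))"
    proof (rule summable_comparison_test')
      \<comment> \<open>The binomial coefficient is at most l^m, which lowers the exponent from Re s
        to Re s - m, still greater than 1.\<close>
      show "summable (\<lambda>n. 2 ^ Suc m * 2 powr (- (Re s - real m)) *
                (real n + real (Suc m) / 2) powr (- (Re s - real m)))"
        using s by (intro summable_mult summable_shifted_powr) auto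
      fix n :: nat
      have "norm (c n) = 2 ^ Suc m * real ((n + m) choose m)"
        by (simp add: c_def norm_mult norm_power)
      also have "\<dots> \<le> 2 ^ Suc m * l n ^ m"
        by (intro mult_left_mono order_trans[OF binomial_le_power] power_mono) (auto simp: l_def)
      finally have "norm (c n) * l n powr (- Re s) \<le> 2 ^ Suc m * l n ^ m * l n powr (- Re s)"
        by (rule mult_right_mono) auto
      also have "\<dots> = 2 ^ Suc m * l n powr (- (Re s - real m))"
        using l[of n] by (simp add: powr_diff powr_minus powr_realpow field_simps)
      also have "l n powr (- (Re s - real m)) =
           2 powr (- (Re s - real m)) * (real n + real (Suc m) / 2) powr (- (Re s - real m))"
      proof -
        have "l n = 2 * (real n + real (Suc m) / 2)" by (simp add: l_def)
        then show ?thesis by (simp only: powr_mult)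
      qed
      finally show "norm (norm (c n) * l n powr (- Re s)) \<le> 2 ^ Suc m * 2 powr (- (Re s - real m)) *
                (real n + real (Suc m) / 2) powr (- (Re s - real m))"
        by (simp add: mult.assoc)
    qed
    show "(\<lambda>n. c n * of_real (exp (- (l n * x)))) sums csech_pow (Suc m) (of_real x)" if "x > 0" for x
      using sums_of_real[OF sech_pow_series[OF that, of m], where 'a = complex]
      unfolding csech_pow_of_real by (simp add: c_def l_def del: power_Suc of_nat_Suc)
  qed (use s l in auto)
  also have "rGamma s * mellin (\<lambda>x. csech_pow (Suc m) (of_real x)) s = mellin_ext (csech_pow (Suc m)) s"
    using s by (intro mellin_ext_eq_mellin[symmetric] strip_decay_csech_pow) auto
  finally have 1: "(\<lambda>n. c n * of_real (l n) powr (- s)) sums mellin_ext (csech_pow (Suc m)) s" .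
  have "(\<lambda>n. \<Sum>k\<le>m. (-1/2) ^ k * gen_stirling k m (of_nat (Suc m) / 2) *
           ((-1) ^ n * of_real (real n / 2 + a) powr (- (s - of_nat m + of_nat k)))) sums stirling_eta m s"
    unfolding stirling_eta_def a_def[symmetric] using s a
    by (intro sums_sum sums_mult eta_series) auto
  then have 2: "(\<lambda>n. 2 ^ (2 * m + 1) / fact m * 4 powr (- s) * (\<Sum>k\<le>m. (-1/2) ^ k * gen_stirling k m (of_nat (Suc m) / 2) *
           ((-1) ^ n * of_real (real n / 2 + a) powr (- (s - of_nat m + of_nat k))))) sums
           (2 ^ (2 * m + 1) / fact m * 4 powr (- s) * stirling_eta m s)"
    by (rule sums_mult)
  have "c n * of_real (l n) powr (- s) = 2 ^ (2 * m + 1) / fact m * 4 powr (- s) *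
      (\<Sum>k\<le>m. (-1/2) ^ k * gen_stirling k m (of_nat (Suc m) / 2) *
           ((-1) ^ n * of_real (real n / 2 + a) powr (- (s - of_nat m + of_nat k))))" for n
  proof -
    \<comment> \<open>In terms of u the exponent is 4u and the argument of the Stirling expansion is
      2u.\<close>
    define u where "u = complex_of_real (real n / 2 + a)"
    have u: "u \<noteq> 0"
      unfolding u_def of_real_eq_0_iff using a by (smt (verit) divide_nonneg_nonneg of_nat_0_le_iff)
    have "complex_of_real (l n) = 4 * u"
      by (simp add: l_def u_def a_def)
    moreover have "(4 * u) powr (- s) = 4 powr (- s) * u powr (- s)"
      by (rule powr_times_real_left) auto
    ultimately have lu: "of_real (l n) powr (- s) = 4 powr (- s) * u powr (- s)"
      by (simp only:)
    have "of_nat ((n + m) choose m) * fact m =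
           (\<Sum>k\<le>m. (-1) ^ k * gen_stirling k m (of_nat (Suc m) / 2) * (of_nat n + of_nat (Suc m) / 2 :: complex) ^ (m - k))"
      by (rule binomial_times_fact_eq_stirling)
    also have "of_nat n + of_nat (Suc m) / 2 = 2 * u"
      by (simp add: u_def a_def)
    finally have "c n * of_real (l n) powr (- s) = 2 ^ Suc m * (-1) ^ n / fact m * 
        (\<Sum>k\<le>m. (-1) ^ k * gen_stirling k m (of_nat (Suc m) / 2) * (2 * u) ^ (m - k)) * (4 powr (- s) * u powr (- s))"
      unfolding c_def lu by (simp add: field_simps del: power_Suc of_nat_Suc)
    also have "\<dots> = (\<Sum>k\<le>m. 2 ^ Suc m * (-1) ^ n / fact m * 
        ((-1) ^ k * gen_stirling k m (of_nat (Suc m) / 2) * (2 * u) ^ (m - k)) * (4 powr (- s) * u powr (- s)))"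
      by (simp only: sum_distrib_left sum_distrib_right)
    also have "\<dots> = (\<Sum>k\<le>m. 2 ^ (2 * m + 1) / fact m * 4 powr (- s) *
       ((-1/2) ^ k * gen_stirling k m (of_nat (Suc m) / 2) *
           ((-1) ^ n * u powr (- (s - of_nat m + of_nat k)))))"
    proof (rule sum.cong[OF refl])
      fix k assume "k \<in> {..m}"
      then have k: "k \<le> m" by simp
      have "u powr (- (s - of_nat m + of_nat k)) = u powr (of_nat (m - k) + (- s))"
        using k by (simp add: of_nat_diff algebra_simps)
      also have "\<dots> = u ^ (m - k) * u powr (- s)"
        by (simp only: powr_add powr_complexpow[OF u])
      finally have pu: "u powr (- (s - of_nat m + of_nat k)) = u ^ (m - k) * u powr (- s)" .
      \<comment> \<open>Collects the powers of 2: m + 1 from the series of sech^(m+1) and m - k from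
        (2u)^(m-k) give 2^(2m+1) and the factor 2^(-k) of the bracket sum.\<close>
      have coeff: "(2::complex) ^ (2 * m + 1) * (-1/2) ^ k = 2 ^ Suc m * ((-1) ^ k * 2 ^ (m - k))"
      proof -
        have "2 * m + 1 = Suc m + (m - k) + k" using k by simp
        then have p2: "(2::complex) ^ (2 * m + 1) = 2 ^ Suc m * 2 ^ (m - k) * 2 ^ k"
          by (simp only: power_add)
        have hk: "2 ^ k * (-1/2 :: complex) ^ k = (-1) ^ k"
          by (simp only: power_divide) simp
        show ?thesis
          unfolding p2 hk[symmetric] by (simp only: mult_ac)
      qed
      have rearrange: "C * M / F * (D * G * (E * U)) * (P * V) = A / F * P * (B * G * (M * (U * V)))"
        if AB: "A * B = C * (D * E)" for A B C D E F G M P U V :: complex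
      proof -
        have "A / F * P * (B * G * (M * (U * V))) = (A * B) * (P * (G * (M * (U * V)))) / F"
          by (simp add: mult_ac)
        also have "\<dots> = C * M / F * (D * G * (E * U)) * (P * V)"
          unfolding AB by (simp add: mult_ac)
        finally show ?thesis ..
      qed
      show "2 ^ Suc m * (-1) ^ n / fact m * 
        ((-1) ^ k * gen_stirling k m (of_nat (Suc m) / 2) * (2 * u) ^ (m - k)) * (4 powr (- s) * u powr (- s)) =
        2 ^ (2 * m + 1) / fact m * 4 powr (- s) * ((-1/2) ^ k * gen_stirling k m (of_nat (Suc m) / 2) *
           ((-1) ^ n * u powr (- (s - of_nat m + of_nat k))))"
        unfolding pu power_mult_distrib by (rule rearrange[OF coeff])
    qed
    finally show ?thesis
      unfolding u_def by (simp only: sum_distrib_left)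
  qed
  with 1 2 show "mellin_ext (csech_pow (Suc m)) s = 2 ^ (2 * m + 1) / fact m * 4 powr (- s) * stirling_eta m s"
    by (simp add: sums_iff)
qed (auto simp: open_halfspace_Re_gt)

text \<open>The index k = m reaches the bracket argument 1, whose reading as a limit is covered by
  \<open>zeta_bracket_eq\<close>.\<close>

lemma stirling_eta_has_derivative:
  "(stirling_eta m has_field_derivative
     (\<Sum>k=0..m. (-1/2) ^ k * gen_stirling k m (of_nat (Suc m) / 2) *
        zeta_bracket (of_nat k - of_nat m + 1) (real (Suc m) / 4) ((real (Suc m) + 2) / 4))) (at 1)"
proof -
  define a where "a = real (Suc m) / 4"
  have a: "a > 0" by (simp add: a_def)
  let ?E = "mellin_ext (eta_kernel a)"
  have br: "zeta_bracket s a ((real (Suc m) + 2) / 4) = deriv ?E s" for s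
  proof -
    have "(real (Suc m) + 2) / 4 = a + 1 / 2" by (simp add: a_def field_simps)
    then show ?thesis using zeta_bracket_eq[OF a, of s] by (simp only:)
  qed
  have "(?E has_field_derivative deriv ?E s) (at s)" for s
    using mellin_ext_holomorphic[OF strip_decay_eta_kernel[OF a], of UNIV]
    by (intro holomorphic_derivI) auto
  then have "((\<lambda>s. ?E (s - of_nat m + of_nat k)) has_field_derivative deriv ?E (1 - of_nat m + of_nat k) * 1) (at 1)" for k
    by (intro DERIV_chain2[where f = ?E]) (auto intro!: derivative_eq_intros)
  then have "(stirling_eta m has_field_derivative
     (\<Sum>k\<le>m. (-1/2) ^ k * gen_stirling k m (of_nat (Suc m) / 2) * (deriv ?E (1 - of_nat m + of_nat k) * 1))) (at 1)"
    unfolding stirling_eta_def a_def[symmetric] by (intro DERIV_sum DERIV_cmult)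
  moreover have "1 - of_nat m + of_nat k = (of_nat k - of_nat m + 1 :: complex)" for k
    by simp
  ultimately show ?thesis
    unfolding a_def[symmetric] br by (simp only: atLeast0AtMost mult_1_right)
qed

section \<open>Identification of the constants with integrals\<close>

lemma sech_F_eq_integral:
  assumes "j \<ge> 2"
  shows "sech_F j = of_real ((\<integral>x. (1 - sech x ^ j) / x\<^sup>2 \<partial>halfline) - 4 * catalan_const / pi)"
proof -
  obtain m where j: "j = Suc m" using assms by (cases j) auto
  define Q1 where "Q1 = (\<Sum>k=0..j-1. (-1/2) ^ k * gen_stirling k (j - 1) (of_nat j / 2) *
             zeta_bracket (of_nat k - of_nat j + 2) (real j / 4) ((real j + 2) / 4))"
  define Q2 where "Q2 = (\<Sum>k=0..j+1. (-1/2) ^ k * gen_stirling k (j + 1) ((of_nat j + 2) / 2) *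
             zeta_bracket (of_nat k - of_nat j) ((real j + 2) / 4) ((real j + 4) / 4))"
  define c1 :: complex where "c1 = of_nat j ^ 2 * (2 ^ (2 * m + 1) / fact m)"
  define c2 :: complex where "c2 = of_nat j * (of_nat j + 1) * (2 ^ (2 * (m + 2) + 1) / fact (m + 2))"
  define R where "R = (\<lambda>s. c1 * stirling_eta m s - c2 * stirling_eta (m + 2) s)"
  have comb: "sech_mellin_comb j = (\<lambda>s. 4 powr (- s) * R s)"
  proof
    fix s
    have "sech_mellin_comb j s = of_nat j ^ 2 * (2 ^ (2 * m + 1) / fact m * 4 powr (- s) * stirling_eta m s) -
        of_nat j * (of_nat j + 1) * (2 ^ (2 * (m + 2) + 1) / fact (m + 2) * 4 powr (- s) * stirling_eta (m + 2) s)"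
      unfolding sech_mellin_comb_def using mellin_ext_csech_pow[of m s] mellin_ext_csech_pow[of "m + 2" s]
      by (simp only: j add_Suc)
    then show "sech_mellin_comb j s = 4 powr (- s) * R s"
      unfolding R_def c1_def c2_def right_diff_distrib by (simp only: mult_ac)
  qed
  \<comment> \<open>Since 4^(-s) has no zeros, R inherits the zero of the combination. The product
    rule at 1 then loses its Ln 4 term and leaves R'(1) / 4.\<close>
  have R1: "R 1 = 0"
    using sech_mellin_comb_at_1(1)[of j] assms by (simp add: comb)
  have d1: "(stirling_eta m has_field_derivative Q1) (at 1)"
    using stirling_eta_has_derivative[of m] unfolding Q1_def j
    by (simp add: algebra_simps)
  have d2: "(stirling_eta (m + 2) has_field_derivative Q2) (at 1)"
    using stirling_eta_has_derivative[of "m + 2"] unfolding Q2_def j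
    by (simp add: algebra_simps)
  have dR: "(R has_field_derivative c1 * Q1 - c2 * Q2) (at 1)"
    unfolding R_def by (intro DERIV_diff DERIV_cmult d1 d2)
  have "((\<lambda>s. 4 powr (- s)) has_field_derivative - (4 powr (- 1) * Ln 4)) (at (1 :: complex))"
    by (auto simp: powr_def intro!: derivative_eq_intros)
  from DERIV_mult[OF this dR] have "(sech_mellin_comb j has_field_derivative (c1 * Q1 - c2 * Q2) / 4) (at 1)"
    unfolding comb by (simp add: R1 powr_minus)
  moreover have "(sech_mellin_comb j has_field_derivative
            of_real (\<integral>x. (1 - sech x ^ j) / x\<^sup>2 \<partial>halfline)) (at 1)"
    using assms by (intro sech_mellin_comb_at_1) auto
  ultimately have I: "(c1 * Q1 - c2 * Q2) / 4 = of_real (\<integral>x. (1 - sech x ^ j) / x\<^sup>2 \<partial>halfline)"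
    by (rule DERIV_unique)
  \<comment> \<open>Here j >= 2 matters: the truncated difference 2j - 3 is a true one, and 2m + 1 =
    (2j - 3) + 2.\<close>
  have c1: "c1 / 4 = 2 ^ (2 * j - 3) * of_nat j ^ 2 / fact (j - 1)"
  proof -
    have "2 * m + 1 = (2 * j - 3) + 2" using assms j by simp
    then have "(2 :: complex) ^ (2 * m + 1) = 2 ^ (2 * j - 3) * 4"
      by (simp only: power_add) simp
    then show ?thesis by (simp add: c1_def j del: of_nat_Suc power_Suc)
  qed
  \<comment> \<open>The factor j (j + 1) of the second derivative cancels against (m+2)! = (j + 1) j
    (j - 1)!.\<close>
  have c2: "c2 / 4 = 2 ^ (2 * j + 1) / fact (j - 1)"
  proof -
    have "2 * (m + 2) + 1 = (2 * j + 1) + 2" using j by simp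
    then have "(2 :: complex) ^ (2 * (m + 2) + 1) = 2 ^ (2 * j + 1) * 4"
      by (simp only: power_add) simp
    moreover have "(fact (m + 2) :: complex) = of_nat j * (of_nat j + 1) * fact m"
      by (simp add: j algebra_simps)
    moreover have "(of_nat j + 1 :: complex) \<noteq> 0" "(of_nat j :: complex) \<noteq> 0"
      using assms by (auto simp flip: of_nat_Suc simp: add.commute)
    ultimately show ?thesis by (simp add: c2_def j del: of_nat_Suc power_Suc)
  qed
  have "sech_F j = - of_real (4 * catalan_const / pi) + c1 / 4 * Q1 - c2 / 4 * Q2"
    using assms unfolding c1 c2 Q1_def Q2_def by (simp add: sech_F_def)
  also have "\<dots> = (c1 * Q1 - c2 * Q2) / 4 - of_real (4 * catalan_const / pi)"
    by (simp add: algebra_simps diff_divide_distrib)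
  finally show ?thesis unfolding I by simp
qed

lemma has_bochner_integral_sech_diff:
  assumes "j \<ge> 1"
  shows "has_bochner_integral halfline (\<lambda>x. complex_of_real ((sech x - sech x ^ j) / x\<^sup>2)) (sech_F j)"
proof (cases "j = 1")
  case True
  then show ?thesis
    by (simp add: sech_F_def has_bochner_integral_zero)
next
  case False
  have "has_bochner_integral halfline (\<lambda>x. (1 - sech x ^ j) / x\<^sup>2 - (1 - sech x) / x\<^sup>2)
     ((\<integral>x. (1 - sech x ^ j) / x\<^sup>2 \<partial>halfline) - 4 * catalan_const / pi)"
    by (intro has_bochner_integral_diff has_bochner_integral_one_minus_sech
        has_bochner_integral_integrable integrable_one_minus_sech_pow)
  then have "has_bochner_integral halfline (\<lambda>x. (sech x - sech x ^ j) / x\<^sup>2)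
     ((\<integral>x. (1 - sech x ^ j) / x\<^sup>2 \<partial>halfline) - 4 * catalan_const / pi)"
    by (simp flip: diff_divide_distrib)
  then show ?thesis
    using sech_F_eq_integral[of j] assms False by (simp only: has_bochner_integral_of_real)
qed

text \<open>The coefficient of sech must be the total weight for the integrand to split into the
  differences sech - sech^j; the binomial identities below evaluate that total for the two choices
  of weights.\<close>

lemma has_bochner_integral_sech_combination:
  fixes w :: "nat \<Rightarrow> real"
  assumes "finite J" "\<And>j. j \<in> J \<Longrightarrow> j \<ge> 1"
  shows "has_bochner_integral halfline
           (\<lambda>x. complex_of_real (((\<Sum>j\<in>J. w j) * sech x - (\<Sum>j\<in>J. w j * sech x ^ j)) / x\<^sup>2))
           (\<Sum>j\<in>J. of_real (w j) * sech_F j)"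
proof -
  have "has_bochner_integral halfline
          (\<lambda>x. \<Sum>j\<in>J. of_real (w j) * complex_of_real ((sech x - sech x ^ j) / x\<^sup>2))
          (\<Sum>j\<in>J. of_real (w j) * sech_F j)"
    using assms by (intro has_bochner_integral_sum has_bochner_integral_mult_right has_bochner_integral_sech_diff)
  moreover have "(\<Sum>j\<in>J. of_real (w j) * complex_of_real ((sech x - sech x ^ j) / x\<^sup>2)) =
        complex_of_real (((\<Sum>j\<in>J. w j) * sech x - (\<Sum>j\<in>J. w j * sech x ^ j)) / x\<^sup>2)" for x
  proof -
    have "(\<Sum>j\<in>J. of_real (w j) * complex_of_real ((sech x - sech x ^ j) / x\<^sup>2)) =
          of_real (\<Sum>j\<in>J. (w j * sech x - w j * sech x ^ j) / x\<^sup>2)"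
      by (simp add: right_diff_distrib)
    also have "(\<Sum>j\<in>J. (w j * sech x - w j * sech x ^ j) / x\<^sup>2) =
          ((\<Sum>j\<in>J. w j) * sech x - (\<Sum>j\<in>J. w j * sech x ^ j)) / x\<^sup>2"
      by (simp only: sum_divide_distrib[symmetric] sum_subtractf sum_distrib_right)
    finally show ?thesis .
  qed
  ultimately show ?thesis by simp
qed

section \<open>The two binomial sums\<close>

lemma sum_ballot_binomials:
  assumes "1 \<le> m" "m \<le> N"
  shows "(\<Sum>j=m..N. (2 * N - j - 1) choose (N - j)) = (2 * N - m) choose (N - m)"
proof -
  \<comment> \<open>With k = N - j this becomes a sum along a diagonal of Pascal's triangle.\<close>
  have "(\<Sum>j=m..N. (2 * N - j - 1) choose (N - j)) = (\<Sum>k\<le>N-m. (N - 1 + k) choose k)"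
    by (rule sum.reindex_bij_witness[of _ "\<lambda>k. N - k" "\<lambda>j. N - j"]) (use assms in \<open>auto simp: mult_2\<close>)
  also have "\<dots> = Suc (N - 1 + (N - m)) choose (N - m)"
    by (rule sum_choose_lower)
  also have "Suc (N - 1 + (N - m)) = 2 * N - m"
    using assms by simp
  finally show ?thesis .
qed

text \<open>Writing the weight j as a sum of ones over m = 1..j and exchanging the sums reduces to
  \<open>sum_ballot_binomials\<close> for each m, followed by another diagonal sum.\<close>

lemma sum_weighted_ballot_binomials:
  assumes N: "N \<ge> 1"
  shows "(\<Sum>j=1..N. real j / real N * real ((2 * N - j - 1) choose (N - 1))) =
           1 / (real N + 1) * real ((2 * N) choose N)"
proof -
  have sym: "(2 * N - j - 1) choose (N - 1) = (2 * N - j - 1) choose (N - j)" if "j \<in> {1..N}" for j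
    using binomial_symmetric[of "N - j" "2 * N - j - 1"] that by simp
  have "(\<Sum>j=1..N. j * ((2 * N - j - 1) choose (N - 1))) =
        (\<Sum>j=1..N. \<Sum>m=1..j. (2 * N - j - 1) choose (N - j))"
    by (rule sum.cong[OF refl], subst sym, assumption, simp)
  also have "\<dots> = (\<Sum>m=1..N. \<Sum>j=m..N. (2 * N - j - 1) choose (N - j))"
    by (subst sum.Sigma, simp, simp, subst sum.Sigma, simp, simp)
       (rule sum.reindex_bij_witness[of _ "\<lambda>(m, j). (j, m)" "\<lambda>(j, m). (m, j)"]; auto)
  also have "\<dots> = (\<Sum>m=1..N. (2 * N - m) choose (N - m))"
    by (intro sum.cong sum_ballot_binomials) auto
  also have "\<dots> = (\<Sum>k\<le>N-1. (N + k) choose k)"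
    by (rule sum.reindex_bij_witness[of _ "\<lambda>k. N - k" "\<lambda>j. N - j"]) (use N in \<open>auto simp: mult_2\<close>)
  also have "\<dots> = Suc (N + (N - 1)) choose (N - 1)"
    by (rule sum_choose_lower)
  also have "Suc (N + (N - 1)) = 2 * N" using N by simp
  finally have S: "(\<Sum>j=1..N. j * ((2 * N - j - 1) choose (N - 1))) = (2 * N) choose (N - 1)" .
  \<comment> \<open>Two absorption identities give N binom(2N,N) = (N+1) binom(2N,N-1), which turns
    binom(2N,N-1) / N into the Catalan number.\<close>
  have "N * ((2 * N) choose N) = 2 * N * ((2 * N - 1) choose (N - 1))"
    using N by (intro times_binomial_minus1_eq) auto
  also have "\<dots> = (2 * N - (N - 1)) * ((2 * N) choose (N - 1))"
    by (rule binomial_absorb_comp[symmetric])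
  also have "2 * N - (N - 1) = N + 1" using N by simp
  finally have "real (N * ((2 * N) choose N)) = real ((N + 1) * ((2 * N) choose (N - 1)))"
    by (rule arg_cong)
  then have A: "real N * real ((2 * N) choose N) = (real N + 1) * real ((2 * N) choose (N - 1))"
    by (simp only: of_nat_mult of_nat_add of_nat_1)
  have "(\<Sum>j=1..N. real j / real N * real ((2 * N - j - 1) choose (N - 1))) =
        real (\<Sum>j=1..N. j * ((2 * N - j - 1) choose (N - 1))) / real N"
    by (simp add: sum_divide_distrib)
  also have "\<dots> = real ((2 * N) choose (N - 1)) / real N"
    unfolding S ..
  also have "\<dots> = 1 / (real N + 1) * real ((2 * N) choose N)"
    using A N by (simp add: field_simps)
  finally show ?thesis .
qed

theorem theorem1:
  fixes N :: nat
  assumes "N \<ge> 1"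
  shows "(\<forall>m\<in>{1..N}.
           has_bochner_integral (restrict_space lborel {0<..})
             (\<lambda>x::real. complex_of_real
                ((real ((2 * N - m) choose (N - m)) * sech x
                  - (\<Sum>j=m..N. real ((2 * N - j - 1) choose (N - j)) * sech x ^ j)) / x\<^sup>2))
             (\<Sum>j=m..N. of_nat ((2 * N - j - 1) choose (N - j)) * sech_F j))
       \<and> has_bochner_integral (restrict_space lborel {0<..})
             (\<lambda>x::real. complex_of_real
                ((1 / (real N + 1) * real ((2 * N) choose N) * sech x
                  - (\<Sum>j=1..N. real j / real N * real ((2 * N - j - 1) choose (N - 1)) * sech x ^ j)) / x\<^sup>2))
             (\<Sum>j=1..N. of_nat j / of_nat N * of_nat ((2 * N - j - 1) choose (N - 1)) * sech_F j)"
proof (intro conjI ballI)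
  fix m assume m: "m \<in> {1..N}"
  then have "real ((2 * N - m) choose (N - m)) = (\<Sum>j=m..N. real ((2 * N - j - 1) choose (N - j)))"
    by (simp only: sum_ballot_binomials[symmetric] atLeastAtMost_iff of_nat_sum)
  then show "has_bochner_integral (restrict_space lborel {0<..})
             (\<lambda>x::real. complex_of_real
                ((real ((2 * N - m) choose (N - m)) * sech x
                  - (\<Sum>j=m..N. real ((2 * N - j - 1) choose (N - j)) * sech x ^ j)) / x\<^sup>2))
             (\<Sum>j=m..N. of_nat ((2 * N - j - 1) choose (N - j)) * sech_F j)"
    using has_bochner_integral_sech_combination[of "{m..N}" "\<lambda>j. real ((2 * N - j - 1) choose (N - j))"] m
    by simp
next
  show "has_bochner_integral (restrict_space lborel {0<..})
             (\<lambda>x::real. complex_of_real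
                ((1 / (real N + 1) * real ((2 * N) choose N) * sech x
                  - (\<Sum>j=1..N. real j / real N * real ((2 * N - j - 1) choose (N - 1)) * sech x ^ j)) / x\<^sup>2))
             (\<Sum>j=1..N. of_nat j / of_nat N * of_nat ((2 * N - j - 1) choose (N - 1)) * sech_F j)"
    using has_bochner_integral_sech_combination[of "{1..N}" "\<lambda>j. real j / real N * real ((2 * N - j - 1) choose (N - 1))"]
    unfolding sum_weighted_ballot_binomials[OF assms] by simp
qed

end
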